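(* Let $\mathbf{k}$ be a field of characteristic $0$, $V$ a finite-dimensional $\mathbf{k}$-vector space, and $X \subseteq V$ a conical subscheme. For every positive integer $r$ there is an integer $C_X(r)$, depending on $r$ and $X$ but independent of $d$, such that for every $d \ge 1$ the ideal of $\mathrm{Sec}_{d,r}(X)$ is generated by polynomials of degree $\le C_X(r)$.
   Context: A subscheme $X \subseteq V$ is conical if its defining ideal $I_X \subseteq \mathrm{Sym}(V^* )$ is homogeneous. Put $B = \mathrm{Sym}(V^* )/I_X = \bigoplus_{e\ge 0} B_e$. For a vector space $W$ and ideals $I,J \subseteq \mathrm{Sym}(W)$, the join $I \star J$ is the kernel of the composite $\mathrm{Sym}(W) \xrightarrow{\Delta} \mathrm{Sym}(W)\otimes\mathrm{Sym}(W) \to \mathrm{Sym}(W)/I \otimes \mathrm{Sym}(W)/J$, where $\Delta$ is the standard comultiplication (the algebra homomorphism with $\Delta(w) = w\otimes 1 + 1 \otimes w$ for $w \in W$); set $I^{\star 1}=I$ and $I^{\star r} = I \star I^{\star(r-1)}$. The ideal of the $d$th Veronese embedding of $X$ is the kernel $J_d \subseteq \mathrm{Sym}(B_d)$ of the surjection $\mathrm{Sym}(B_d) \to \bigoplus_{e \ge 0} B_{de}$ induced by multiplication in $B$, and $\mathrm{Sec}_{d,r}(X)$ is the subscheme of $B_d^*$ defined by the ideal $J_d^{\star r} \subseteq \mathrm{Sym}(B_d)$; this ideal is what "the ideal of $\mathrm{Sec}_{d,r}(X)$" refers to. *)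

theory Defs
  imports Main "HOL-Library.Poly_Mapping"
begin

text \<open>Polynomials over a field 'k in variables indexed by nat, as finitely supported
  maps from monomials (finitely supported exponent vectors) to coefficients.
  The ring structure (+, *, 0, 1) is the one provided by HOL-Library.Poly_Mapping.\<close>

type_synonym 'k mpoly = "(nat \<Rightarrow>\<^sub>0 nat) \<Rightarrow>\<^sub>0 'k"

definition mvar :: "nat \<Rightarrow> 'k::comm_ring_1 mpoly" where
  "mvar i = Poly_Mapping.single (Poly_Mapping.single i 1) 1"

definition mconst :: "'k::comm_ring_1 \<Rightarrow> 'k mpoly" where
  "mconst c = Poly_Mapping.single 0 c"

text \<open>Total degree of a monomial and of a polynomial.\<close>
definition mon_deg :: "(nat \<Rightarrow>\<^sub>0 nat) \<Rightarrow> nat" where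
  "mon_deg m = (\<Sum>i\<in>Poly_Mapping.keys m. Poly_Mapping.lookup m i)"

definition total_deg :: "'k::comm_ring_1 mpoly \<Rightarrow> nat" where
  "total_deg p = Max (insert 0 (mon_deg ` Poly_Mapping.keys p))"

text \<open>The polynomial ring k[x_0,...,x_{n-1}] (= Sym of an n-dimensional space) as a subset.\<close>
definition poly_ring :: "nat \<Rightarrow> 'k::comm_ring_1 mpoly set" where
  "poly_ring n = {p. \<forall>m\<in>Poly_Mapping.keys p. Poly_Mapping.keys m \<subseteq> {..<n}}"

text \<open>Homogeneous component of degree e, and homogeneous polynomials of degree e.\<close>
definition hcomp :: "nat \<Rightarrow> 'k::comm_ring_1 mpoly \<Rightarrow> 'k mpoly" where
  "hcomp e p = (\<Sum>m\<in>{m\<in>Poly_Mapping.keys p. mon_deg m = e}.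
                    Poly_Mapping.single m (Poly_Mapping.lookup p m))"

definition homog_of_deg :: "nat \<Rightarrow> nat \<Rightarrow> 'k::comm_ring_1 mpoly set" where
  "homog_of_deg n e = {p \<in> poly_ring n. \<forall>m\<in>Poly_Mapping.keys p. mon_deg m = e}"

text \<open>Evaluation / substitution: the k-algebra homomorphism sending x_i to f i.\<close>
definition mpoly_eval :: "(nat \<Rightarrow> 'k::comm_ring_1 mpoly) \<Rightarrow> 'k mpoly \<Rightarrow> 'k mpoly" where
  "mpoly_eval f p = (\<Sum>m\<in>Poly_Mapping.keys p.
      mconst (Poly_Mapping.lookup p m) *
      (\<Prod>i\<in>Poly_Mapping.keys m. f i ^ Poly_Mapping.lookup m i))"

text \<open>Ideals of the subring R, and the ideal of R generated by a set S.\<close>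
definition is_ideal_in :: "'k::comm_ring_1 mpoly set \<Rightarrow> 'k mpoly set \<Rightarrow> bool" where
  "is_ideal_in R I \<longleftrightarrow> I \<subseteq> R \<and> 0 \<in> I \<and> (\<forall>p\<in>I. \<forall>q\<in>I. p + q \<in> I)
      \<and> (\<forall>p\<in>I. \<forall>q\<in>R. q * p \<in> I)"

definition ideal_gen :: "'k::comm_ring_1 mpoly set \<Rightarrow> 'k mpoly set \<Rightarrow> 'k mpoly set" where
  "ideal_gen R S = {(\<Sum>s\<in>F. c s * s) | F c. finite F \<and> F \<subseteq> S \<and> (\<forall>s\<in>F. c s \<in> R)}"

text \<open>A conical subscheme X of V = k^n: its ideal I_X is a homogeneous ideal of Sym(V^*).\<close>
definition conical :: "nat \<Rightarrow> 'k::comm_ring_1 mpoly set \<Rightarrow> bool" where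
  "conical n I \<longleftrightarrow> is_ideal_in (poly_ring n) I \<and> (\<forall>p\<in>I. \<forall>e. hcomp e p \<in> I)"

text \<open>b_0,...,b_{N-1} are homogeneous of degree d and their classes form a basis of
  B_d = Sym_d(V^*) / (I_X)_d.\<close>
definition basis_mod :: "nat \<Rightarrow> 'k::comm_ring_1 mpoly set \<Rightarrow> nat \<Rightarrow> nat \<Rightarrow> (nat \<Rightarrow> 'k mpoly) \<Rightarrow> bool" where
  "basis_mod n I d N b \<longleftrightarrow>
     (\<forall>j<N. b j \<in> homog_of_deg n d) \<and>
     (\<forall>s\<in>homog_of_deg n d. \<exists>c. s - (\<Sum>j<N. mconst (c j) * b j) \<in> I) \<and>
     (\<forall>c. (\<Sum>j<N. mconst (c j) * b j) \<in> I \<longrightarrow> (\<forall>j<N. c j = 0))"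

text \<open>Identifying Sym(B_d) with k[y_0,...,y_{N-1}] via the basis b, the ideal J_d of the d-th
  Veronese embedding is the kernel of Sym(B_d) -> B, y_j |-> class of b_j.\<close>
definition veronese_ideal :: "'k::comm_ring_1 mpoly set \<Rightarrow> nat \<Rightarrow> (nat \<Rightarrow> 'k mpoly) \<Rightarrow> 'k mpoly set" where
  "veronese_ideal I N b = {q \<in> poly_ring N. mpoly_eval b q \<in> I}"

text \<open>Join of ideals I, J of Sym(W) = k[y_0..y_{N-1}]: Sym(W) (x) Sym(W) is identified with
  k[y_0..y_{2N-1}] (first factor: y_j, second factor: y_{N+j}); then
  Sym(W)/I (x) Sym(W)/J = k[y_0..y_{2N-1}] / (I(y) + J(y_{N+.})), and Delta(y_j) = y_j + y_{N+j}.\<close>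
definition join_ideal :: "nat \<Rightarrow> 'k::comm_ring_1 mpoly set \<Rightarrow> 'k mpoly set \<Rightarrow> 'k mpoly set" where
  "join_ideal N I J = {f \<in> poly_ring N.
      mpoly_eval (\<lambda>j. mvar j + mvar (N + j)) f \<in>
        ideal_gen (poly_ring (2 * N)) (I \<union> mpoly_eval (\<lambda>j. mvar (N + j)) ` J)}"

fun join_pow :: "nat \<Rightarrow> 'k::comm_ring_1 mpoly set \<Rightarrow> nat \<Rightarrow> 'k mpoly set" where
  "join_pow N I 0 = I"
| "join_pow N I (Suc 0) = I"
| "join_pow N I (Suc (Suc r)) = join_ideal N I (join_pow N I (Suc r))"

text \<open>The ideal of Sec_{d,r}(X), i.e. J_d^{*r}.\<close>
definition sec_ideal :: "'k::comm_ring_1 mpoly set \<Rightarrow> nat \<Rightarrow> (nat \<Rightarrow> 'k mpoly) \<Rightarrow> nat \<Rightarrow> 'k mpoly set" where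
  "sec_ideal I N b r = join_pow N (veronese_ideal I N b) r"

text \<open>An ideal of k[y_0..y_{N-1}] is generated by polynomials of degree at most C.\<close>
definition generated_in_deg_le :: "nat \<Rightarrow> nat \<Rightarrow> 'k::comm_ring_1 mpoly set \<Rightarrow> bool" where
  "generated_in_deg_le N C J \<longleftrightarrow>
     (\<exists>G. G \<subseteq> J \<and> (\<forall>g\<in>G. total_deg g \<le> C) \<and> ideal_gen (poly_ring N) G = J)"

end

theory Submission
  imports Defs "HOL-Library.Sublist" "HOL-Library.Infinite_Set" "HOL-Library.Product_Lexorder"
    "HOL-Library.FuncSet" "HOL-Combinatorics.Permutations" "HOL.Vector_Spaces"
begin

text \<open>Write \<open>A = k[x\<^sub>j]\<close>. Since tensor products over a field preserve injections, a polynomial \<open>q\<close> in the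
  \<open>y\<^sub>j\<close> lies in the ideal of the secant variety iff substituting \<open>y\<^sub>j \<mapsto> \<Sum>\<^sub>l b\<^sub>j(x\<^sub>l)\<close>, with \<open>r\<close> copies of the
  variables, gives an element of the ideal generated by the \<open>r\<close> copies of \<open>I\<close>.

  A form of degree \<open>e\<close> in the \<open>y\<^sub>j\<close> polarizes (characteristic 0) to a polynomial \<open>F\<close> in \<open>e\<close> rows of
  variables, of degree \<open>d\<close> in each row. It lies in the secant ideal iff every map from the rows to
  \<open>{..<r}\<close> sends \<open>F\<close> into the ideal of the \<open>r\<close> copies. The multihomogeneous \<open>F\<close>
  with this property form a family \<open>K\<close> that does not depend on \<open>d\<close> and is stable under multiplication by
  monomials and under strictly increasing renamings of the rows. By Higman's lemma and a Groebner basis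
  argument \<open>K\<close> is finitely generated under these operations. A generator involving \<open>c\<close> rows, multiplied by a
  monomial, depolarizes to the product of an element of the secant ideal of degree at most \<open>c\<close> and
  further linear forms, so \<open>C\<close> can be taken to be the maximal number of rows of a generator.\<close>

section \<open>Well-quasi-orders\<close>

text \<open>Multidegrees are left arbitrary in \<open>K\<close>, so finite generation is proved once
  from \<open>n\<close>, \<open>I\<close> and \<open>r\<close>; afterwards \<open>d\<close> only
  selects the members that have degree \<open>d\<close> in each of \<open>e\<close> rows. In a row
  where a shifted generator has degree 0, the monomial factor alone supplies degree
  \<open>d\<close>, so this row depolarizes to a linear form; only rows of the generator itself
  remain for the other factor. The number of rows is unbounded, so leading monomials are compared as
  words of exponent vectors, and the renamings have to be increasing in order to respect the
  lexicographic order. Substituting a sum over the copies and multiplying out gives one sum over all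
  maps from the rows to \<open>{..<r}\<close>, whereas \<open>K\<close> requires membership for
  every single map. Homogeneity of \<open>I\<close> closes this gap: functionals that vanish on
  \<open>I\<close> may be cut down to one degree, which isolates the maps with prescribed fibre
  sizes, and symmetry of the polarization makes these contribute equally. Characteristic 0 serves
  twice: it cancels the factorial in the polarization and the number of maps with the same fibre
  sizes.\<close>

definition wqo :: "('a \<Rightarrow> 'a \<Rightarrow> bool) \<Rightarrow> bool" where
  "wqo P \<longleftrightarrow> transp P \<and> (\<forall>f::nat \<Rightarrow> 'a. \<exists>i j. i < j \<and> P (f i) (f j))"

lemma wqo_transD: "wqo P \<Longrightarrow> P x y \<Longrightarrow> P y z \<Longrightarrow> P x z"
  by (auto simp: wqo_def dest: transpD)

lemma wqo_goodD: "wqo P \<Longrightarrow> \<exists>i j. i < j \<and> P (f i) (f (j::nat))"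
  by (auto simp: wqo_def)

text \<open>Indices without a later \<open>P\<close>-successor are finitely many, since infinitely
  many of them would enumerate a bad sequence. Beyond the last one, successors can be followed
  forever, and transitivity relates all pairs.\<close>

lemma wqo_chain_subseq:
  assumes "wqo P"
  shows "\<exists>s::nat \<Rightarrow> nat. strict_mono s \<and> (\<forall>i j. i < j \<longrightarrow> P (f (s i)) (f (s j)))"
proof -
  define Z where "Z = {i. \<forall>j>i. \<not> P (f i) (f j)}"
  have "finite Z"
  proof (rule ccontr)
    assume inf: "infinite Z"
    obtain i j where ij: "i < j" "P (f (Infinite_Set.enumerate Z i)) (f (Infinite_Set.enumerate Z j))"
      using wqo_goodD[OF assms, of "f \<circ> Infinite_Set.enumerate Z"] by auto
    have "Infinite_Set.enumerate Z i \<in> Z" using inf by (simp add: enumerate_in_set)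
    moreover have "Infinite_Set.enumerate Z i < Infinite_Set.enumerate Z j" using ij inf by (simp add: enumerate_mono)
    ultimately show False using ij by (auto simp: Z_def)
  qed
  then obtain b where b: "\<And>i. i \<in> Z \<Longrightarrow> i < b"
    by (meson finite_nat_bounded lessThan_iff subset_iff)
  have "\<exists>s. \<forall>n. b \<le> s n \<and> s n < s (Suc n) \<and> P (f (s n)) (f (s (Suc n)))"
  proof (rule exE[OF dependent_nat_choice])
    show "\<exists>x. b \<le> x" by blast
    show "\<exists>y. b \<le> y \<and> x < y \<and> P (f x) (f y)" if "b \<le> x" for x and n :: nat
    proof -
      have "x \<notin> Z" using b that by force
      then obtain y where "x < y" "P (f x) (f y)" by (auto simp: Z_def)
      thus ?thesis using that by (intro exI[of _ y]) auto
    qed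
  qed blast
  then obtain s where s: "\<And>n. s n < s (Suc n)" "\<And>n. P (f (s n)) (f (s (Suc n)))" by blast
  have "strict_mono s" using s by (simp add: strict_mono_Suc_iff)
  moreover have "P (f (s i)) (f (s (i + Suc k)))" for i k
  proof (induction k)
    case (Suc k)
    then show ?case using wqo_transD[OF assms Suc s(2)] by simp
  qed (use s in auto)
  hence "P (f (s i)) (f (s j))" if "i < j" for i j
    using that by (metis add_Suc_right less_imp_Suc_add)
  ultimately show ?thesis by blast
qed

text \<open>Dickson's lemma: along a subsequence that ascends in the first \<open>n\<close>
  coordinates, coordinate \<open>n\<close> cannot strictly decrease forever.\<close>

lemma wqo_pointwise_le: "wqo (\<lambda>v w :: nat \<Rightarrow> nat. \<forall>j<n. v j \<le> w j)"
proof (induction n)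
  case 0
  show ?case by (auto simp: wqo_def transp_def)
next
  case (Suc n)
  have "\<exists>i j. i < j \<and> (\<forall>k<Suc n. f i k \<le> f j k)" for f :: "nat \<Rightarrow> nat \<Rightarrow> nat"
  proof -
    obtain s :: "nat \<Rightarrow> nat" where s: "strict_mono s"
      "\<And>i j. i < j \<Longrightarrow> \<forall>k<n. f (s i) k \<le> f (s j) k"
      using wqo_chain_subseq[OF Suc, of f] by blast
    have "\<exists>i j. i < j \<and> f (s i) n \<le> f (s j) n"
    proof (rule ccontr)
      assume "\<not> ?thesis"
      hence *: "\<And>i j. i < j \<Longrightarrow> f (s j) n < f (s i) n" by force
      have "f (s i) n + i \<le> f (s 0) n" for i
      proof (induction i)
        case (Suc i)
        then show ?case using *[of i "Suc i"] by simp
      qed simp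
      from this[of "Suc (f (s 0) n)"] show False by simp
    qed
    then obtain i j where "i < j" "f (s i) n \<le> f (s j) n" by blast
    thus ?thesis using s(2)[of i j] strict_monoD[OF s(1)]
      by (intro exI[of _ "s i"] exI[of _ "s j"]) (auto simp: less_Suc_eq)
  qed
  moreover have "transp (\<lambda>v w :: nat \<Rightarrow> nat. \<forall>j<Suc n. v j \<le> w j)"
    by (auto simp: transp_def intro: order_trans)
  ultimately show ?case by (simp add: wqo_def)
qed

text \<open>Higman's lemma, by Nash-Williams' minimal bad sequence argument.\<close>

lemma wqo_list_emb:
  assumes P: "wqo P"
  shows "\<exists>i j. i < j \<and> list_emb P (f i) (f (j::nat))"
proof (rule ccontr)
  define bad where "bad f \<longleftrightarrow> (\<forall>i j. i < j \<longrightarrow> \<not> list_emb P (f i) (f j))" for f :: "nat \<Rightarrow> 'a list"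
  define minat where "minat n f \<longleftrightarrow> bad f \<and> (\<forall>h. bad h \<and> (\<forall>i<n. h i = f i) \<longrightarrow> length (f n) \<le> length (h n))"
    for n :: nat and f
  assume "\<not> ?thesis"
  hence f: "bad f" by (auto simp: bad_def)
  have minimize: "\<exists>f'. minat n f' \<and> (\<forall>i<n. f' i = f i)" if bf: "bad f" for f n
  proof -
    obtain h where h: "bad h \<and> (\<forall>i<n. h i = f i)"
      "\<And>h'. bad h' \<and> (\<forall>i<n. h' i = f i) \<Longrightarrow> length (h n) \<le> length (h' n)"
      using ex_has_least_nat[of "\<lambda>h. bad h \<and> (\<forall>i<n. h i = f i)" f "\<lambda>h. length (h n)"] bf by auto
    thus ?thesis by (intro exI[of _ h]) (auto simp: minat_def)
  qed
  have "\<exists>g. \<forall>n. minat n (g n) \<and> (\<forall>i<Suc n. g (Suc n) i = g n i)"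
  proof (rule exE[OF dependent_nat_choice[where P = minat and Q = "\<lambda>n x y. \<forall>i<Suc n. y i = x i"]])
    show "\<exists>x. minat 0 x" using minimize[OF f] by blast
    show "\<exists>y. minat (Suc n) y \<and> (\<forall>i<Suc n. y i = x i)" if "minat n x" for x n
      using minimize[of x "Suc n"] that by (auto simp: minat_def)
  qed blast
  then obtain g where g: "\<And>n. minat n (g n)" "\<And>n i. i \<le> n \<Longrightarrow> g (Suc n) i = g n i"
    by (auto simp: less_Suc_eq_le)
  \<comment> \<open>The diagonal is bad because it agrees with the bad sequence \<open>g n\<close>
    up to position \<open>n\<close>.\<close>
  define m where "m n = g n n" for n
  have gm: "g n i = m i" if "i \<le> n" for i n
    using that by (induction rule: dec_induct) (auto simp: m_def g(2))
  have bad_m: "\<not> list_emb P (m i) (m j)" if "i < j" for i j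
  proof -
    have "bad (g j)" using g(1)[of j] by (simp add: minat_def)
    thus ?thesis using that gm[of i j] gm[of j j] unfolding bad_def by (metis less_imp_le order_refl)
  qed
  have m_ne: "m i \<noteq> []" for i using bad_m[of i "Suc i"] by auto
  hence m_Cons: "m i = hd (m i) # tl (m i)" for i by simp
  obtain s :: "nat \<Rightarrow> nat" where s: "strict_mono s"
      "\<And>i j. i < j \<Longrightarrow> P (hd (m (s i))) (hd (m (s j)))"
    using wqo_chain_subseq[OF P, of "\<lambda>i. hd (m i)"] by blast
  \<comment> \<open>Follow \<open>m\<close> up to position \<open>s 0\<close>, then use the tails
    along a subsequence with ascending heads. An embedding inside \<open>h\<close> would give one
    inside \<open>m\<close>, so \<open>h\<close> is bad; but its entry at \<open>s 0\<close> is
    shorter than minimality allows.\<close>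
  define h where "h i = (if i < s 0 then m i else tl (m (s (i - s 0))))" for i
  have "bad h"
    unfolding bad_def
  proof (intro allI impI notI)
    fix i j :: nat
    assume ij: "i < j" and emb: "list_emb P (h i) (h j)"
    consider "j < s 0" | "i < s 0" "s 0 \<le> j" | "s 0 \<le> i" using ij by linarith
    thus False
    proof cases
      case 1
      with emb ij bad_m show ?thesis by (auto simp: h_def)
    next
      case 2
      let ?k = "s (j - s 0)"
      have "list_emb P (m i) (hd (m ?k) # tl (m ?k))"
        using 2 emb by (intro list_emb_Cons) (simp add: h_def)
      hence "list_emb P (m i) (m ?k)" by (simp flip: m_Cons)
      moreover have "s 0 \<le> ?k" using s(1) by (simp add: strict_mono_less_eq)
      ultimately show ?thesis using bad_m[of i ?k] 2 by simp
    next
      case 3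
      let ?k = "i - s 0" and ?l = "j - s 0"
      have kl: "?k < ?l" using 3 ij by simp
      have "list_emb P (tl (m (s ?k))) (tl (m (s ?l)))" using emb 3 ij by (simp add: h_def)
      hence "list_emb P (hd (m (s ?k)) # tl (m (s ?k))) (hd (m (s ?l)) # tl (m (s ?l)))"
        using s(2)[OF kl] by (intro list_emb_Cons2)
      hence "list_emb P (m (s ?k)) (m (s ?l))" by (simp flip: m_Cons)
      thus ?thesis using bad_m strict_monoD[OF s(1) kl] by blast
    qed
  qed
  moreover have "\<forall>i<s 0. h i = g (s 0) i" using gm by (auto simp: h_def)
  ultimately have "length (g (s 0) (s 0)) \<le> length (h (s 0))"
    using g(1)[of "s 0"] by (auto simp: minat_def)
  hence "length (m (s 0)) < Suc (length (tl (m (s 0))))"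
    by (simp only: h_def gm[OF order_refl] less_irrefl if_False diff_self_eq_0 less_Suc_eq_le)
  thus False using m_ne[of "s 0"] by (cases "m (s 0)") auto
qed

text \<open>The index map is extended to all of \<open>nat\<close>, because a shift renames all rows
  at once.\<close>

lemma list_emb_strict_mono:
  assumes "list_emb P xs ys"
  shows "\<exists>\<iota>::nat \<Rightarrow> nat. strict_mono \<iota> \<and> (\<forall>i<length xs. \<iota> i < length ys \<and> P (xs ! i) (ys ! \<iota> i))"
  using assms
proof induction
  case (list_emb_Nil ys)
  show ?case by (intro exI[of _ id]) (auto simp: strict_mono_def)
next
  case (list_emb_Cons xs ys y)
  then obtain \<iota> where "strict_mono \<iota>" "\<forall>i<length xs. \<iota> i < length ys \<and> P (xs ! i) (ys ! \<iota> i)" by blast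
  thus ?case by (intro exI[of _ "Suc \<circ> \<iota>"]) (auto simp: strict_mono_def)
next
  case (list_emb_Cons2 x y xs ys)
  then obtain \<iota> where "strict_mono \<iota>" "\<forall>i<length xs. \<iota> i < length ys \<and> P (xs ! i) (ys ! \<iota> i)" by blast
  thus ?case using list_emb_Cons2.hyps(1)
    by (intro exI[of _ "case_nat 0 (Suc \<circ> \<iota>)"])
       (auto simp: strict_mono_Suc_iff nth_Cons split: nat.splits)
qed

text \<open>Otherwise elements could be picked one after the other into a bad sequence.\<close>

lemma good_imp_finite_basis:
  assumes good: "\<And>f::nat \<Rightarrow> 'a. (\<And>i. f i \<in> A) \<Longrightarrow> \<exists>i j. i < j \<and> P (f i) (f j)"
  shows "\<exists>B\<subseteq>A. finite B \<and> (\<forall>a\<in>A. \<exists>b\<in>B. P b a)"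
proof (rule ccontr)
  assume "\<not> ?thesis"
  hence *: "\<exists>a\<in>A. \<forall>b\<in>B. \<not> P b a" if "finite B" "B \<subseteq> A" for B using that by meson
  define pick where "pick B = (SOME a. a \<in> A \<and> (\<forall>b\<in>B. \<not> P b a))" for B
  have pick: "pick B \<in> A \<and> (\<forall>b\<in>B. \<not> P b (pick B))" if "finite B" "B \<subseteq> A" for B
    unfolding pick_def by (rule someI_ex) (use *[OF that] in blast)
  define S where "S = rec_nat {} (\<lambda>_ B. insert (pick B) B)"
  have S_simps: "S 0 = {}" "S (Suc n) = insert (pick (S n)) (S n)" for n by (auto simp: S_def)
  have S: "finite (S n) \<and> S n \<subseteq> A" for n
    by (induction n) (use pick in \<open>auto simp: S_simps\<close>)
  have "pick (S i) \<in> S j" if "i < j" for i j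
    using that by (induction j) (auto simp: S_simps less_Suc_eq)
  moreover have "\<exists>i j. i < j \<and> P (pick (S i)) (pick (S j))"
    by (rule good) (use pick S in simp)
  ultimately show False using pick S by meson
qed

section \<open>Polynomials over an arbitrary set of variables\<close>

lemma poly_mapping_expand: "p = (\<Sum>m\<in>Poly_Mapping.keys p. Poly_Mapping.single m (Poly_Mapping.lookup p m))"
proof (rule poly_mapping_eqI)
  fix k
  show "Poly_Mapping.lookup p k =
      Poly_Mapping.lookup (\<Sum>m\<in>Poly_Mapping.keys p. Poly_Mapping.single m (Poly_Mapping.lookup p m)) k"
    by (cases "k \<in> Poly_Mapping.keys p")
       (auto simp: lookup_sum lookup_single when_def in_keys_iff cong: if_cong)
qed

lemma poly_mapping_single_induct [case_names single add]:
  fixes p :: "'m \<Rightarrow>\<^sub>0 'a::comm_monoid_add"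
  assumes "\<And>m a. P (Poly_Mapping.single m a)" and "\<And>p q. P p \<Longrightarrow> P q \<Longrightarrow> P (p + q)"
  shows "P p"
proof -
  have "P 0" using assms(1)[of _ 0] by simp
  have "P (\<Sum>m\<in>S. Poly_Mapping.single m (Poly_Mapping.lookup p m))" if "finite S" for S
    using that by induction (use \<open>P 0\<close> assms in auto)
  thus ?thesis using poly_mapping_expand[of p] by (metis finite_keys)
qed

lemma keys_sum_subset: "Poly_Mapping.keys (\<Sum>x\<in>S. f x) \<subseteq> (\<Union>x\<in>S. Poly_Mapping.keys (f x))"
  by (induction S rule: infinite_finite_induct) (use keys_add in fastforce)+

lemma keys_add_nat: "Poly_Mapping.keys (m + m' :: 'v \<Rightarrow>\<^sub>0 nat) = Poly_Mapping.keys m \<union> Poly_Mapping.keys m'"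
  by (auto simp: in_keys_iff lookup_add)

subsection \<open>Linear extension\<close>

text \<open>One construction for two purposes: with \<open>c\<close> the identity it is the
  functional with values \<open>h\<close> on monomials, with \<open>c = cst\<close> it yields
  substitution and depolarization.\<close>

definition lext :: "('k::comm_ring_1 \<Rightarrow> 'a::comm_ring_1) \<Rightarrow> ('m \<Rightarrow> 'a) \<Rightarrow> ('m \<Rightarrow>\<^sub>0 'k) \<Rightarrow> 'a" where
  "lext c h p = (\<Sum>m\<in>Poly_Mapping.keys p. c (Poly_Mapping.lookup p m) * h m)"

lemma lext_cong: "(\<And>m. m \<in> Poly_Mapping.keys p \<Longrightarrow> h m = h' m) \<Longrightarrow> lext c h p = lext c h' p"
  by (auto simp: lext_def intro: sum.cong)

locale coeff_hom =
  fixes c :: "'k::comm_ring_1 \<Rightarrow> 'a::comm_ring_1"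
  assumes c_add: "c (x + y) = c x + c y" and c_mult: "c (x * y) = c x * c y" and c_1: "c 1 = 1"
begin

lemma c_0: "c 0 = 0"
  using c_add[of 0 0] by simp

lemma lext_superset:
  assumes "finite S" "Poly_Mapping.keys p \<subseteq> S"
  shows "lext c h p = (\<Sum>m\<in>S. c (Poly_Mapping.lookup p m) * h m)"
  unfolding lext_def using assms
  by (intro sum.mono_neutral_left) (auto simp: in_keys_iff c_0)

lemma lext_0: "lext c h 0 = 0"
  by (simp add: lext_def)

lemma lext_single: "lext c h (Poly_Mapping.single m a) = c a * h m"
  by (simp add: lext_def c_0)

lemma lext_add: "lext c h (p + q) = lext c h p + lext c h q"
proof -
  let ?S = "Poly_Mapping.keys p \<union> Poly_Mapping.keys q"
  have "lext c h (p + q) = (\<Sum>m\<in>?S. c (Poly_Mapping.lookup (p + q) m) * h m)"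
    by (rule lext_superset) (auto simp: keys_add)
  also have "\<dots> = lext c h p + lext c h q"
    by (subst (1 2) lext_superset[of ?S]) (auto simp: lookup_add c_add algebra_simps sum.distrib)
  finally show ?thesis .
qed

lemma lext_sum: "lext c h (\<Sum>x\<in>S. f x) = (\<Sum>x\<in>S. lext c h (f x))"
  by (induction S rule: infinite_finite_induct) (auto simp: lext_0 lext_add)

lemma lext_uminus: "lext c h (- p) = - lext c h p"
proof -
  have "lext c h (- p) + lext c h p = 0" by (simp add: lext_0 flip: lext_add)
  thus ?thesis by (simp add: eq_neg_iff_add_eq_0)
qed

lemma lext_diff: "lext c h (p - q) = lext c h p - lext c h q"
  using lext_add[of h p "- q"] by (simp add: lext_uminus)

text \<open>The three functions may differ and are compared on occurring monomials only. This covers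
  functionals that factor over disjoint rows, and functionals translated by a fixed monomial,
  besides substitution.\<close>

lemma lext_mult:
  fixes p q :: "'m::comm_monoid_add \<Rightarrow>\<^sub>0 'k"
  assumes "\<And>m m'. m \<in> Poly_Mapping.keys p \<Longrightarrow> m' \<in> Poly_Mapping.keys q \<Longrightarrow> h (m + m') = h1 m * h2 m'"
  shows "lext c h (p * q) = lext c h1 p * lext c h2 q"
proof -
  have "p * q = (\<Sum>m\<in>Poly_Mapping.keys p. Poly_Mapping.single m (Poly_Mapping.lookup p m)) *
      (\<Sum>m\<in>Poly_Mapping.keys q. Poly_Mapping.single m (Poly_Mapping.lookup q m))"
    by (simp flip: poly_mapping_expand)
  also have "\<dots> = (\<Sum>m\<in>Poly_Mapping.keys p. \<Sum>m'\<in>Poly_Mapping.keys q.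
      Poly_Mapping.single (m + m') (Poly_Mapping.lookup p m * Poly_Mapping.lookup q m'))"
    by (simp add: sum_product mult_single)
  finally have "lext c h (p * q) = (\<Sum>m\<in>Poly_Mapping.keys p. \<Sum>m'\<in>Poly_Mapping.keys q.
      c (Poly_Mapping.lookup p m) * h1 m * (c (Poly_Mapping.lookup q m') * h2 m'))"
    by (auto simp: lext_sum lext_single c_mult assms mult_ac intro!: sum.cong)
  thus ?thesis by (simp add: lext_def sum_product)
qed

end

interpretation scal: coeff_hom "\<lambda>x. x"
  by unfold_locales auto

definition cst :: "'k::comm_ring_1 \<Rightarrow> ('v \<Rightarrow>\<^sub>0 nat) \<Rightarrow>\<^sub>0 'k" where
  "cst c = Poly_Mapping.single 0 c"

interpretation cst: coeff_hom "cst :: 'k::comm_ring_1 \<Rightarrow> ('v \<Rightarrow>\<^sub>0 nat) \<Rightarrow>\<^sub>0 'k"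
  by unfold_locales (auto simp: cst_def single_add mult_single)

lemma mconst_eq_cst: "mconst = cst"
  by (simp add: fun_eq_iff mconst_def cst_def)

lemma cst_mult_single: "cst a * Poly_Mapping.single m b = Poly_Mapping.single m (a * b)"
  by (simp add: cst_def mult_single)

lemma lookup_cst_mult: "Poly_Mapping.lookup (cst a * p) m = a * Poly_Mapping.lookup p m"
  by (induction p rule: poly_mapping_single_induct)
     (auto simp: cst_mult_single lookup_single when_def lookup_add algebra_simps)

lemma cst_uminus: "cst (- a) = - cst a"
  by (simp add: cst_def single_uminus)

lemma cst_of_nat: "cst (of_nat n) = of_nat n"
  by (simp add: cst_def)

lemma (in coeff_hom) lext_cst_mult: "lext c h (cst a * p) = c a * lext c h p"
  by (induction p rule: poly_mapping_single_induct)
     (auto simp: cst_mult_single lext_single lext_add c_mult algebra_simps)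

subsection \<open>Substitution\<close>

definition mon_eval :: "('v \<Rightarrow> 'a::comm_ring_1) \<Rightarrow> ('v \<Rightarrow>\<^sub>0 nat) \<Rightarrow> 'a" where
  "mon_eval f m = (\<Prod>i\<in>Poly_Mapping.keys m. f i ^ Poly_Mapping.lookup m i)"

lemma mon_eval_superset:
  assumes "finite S" "Poly_Mapping.keys m \<subseteq> S"
  shows "mon_eval f m = (\<Prod>i\<in>S. f i ^ Poly_Mapping.lookup m i)"
  unfolding mon_eval_def using assms
  by (intro prod.mono_neutral_left) (auto simp: in_keys_iff)

lemma mon_eval_0 [simp]: "mon_eval f 0 = 1"
  by (simp add: mon_eval_def)

lemma mon_eval_single: "mon_eval f (Poly_Mapping.single v a) = f v ^ a"
  by (simp add: mon_eval_def)

lemma mon_eval_add: "mon_eval f (m + m') = mon_eval f m * mon_eval f m'"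
proof -
  let ?S = "Poly_Mapping.keys m \<union> Poly_Mapping.keys m'"
  have "mon_eval f (m + m') = (\<Prod>i\<in>?S. f i ^ Poly_Mapping.lookup (m + m') i)"
    by (rule mon_eval_superset) (auto simp: keys_add)
  also have "\<dots> = mon_eval f m * mon_eval f m'"
    by (subst (1 2) mon_eval_superset[of ?S]) (auto simp: lookup_add power_add prod.distrib)
  finally show ?thesis .
qed

lemma mon_eval_cong: "(\<And>v. v \<in> Poly_Mapping.keys m \<Longrightarrow> f v = g v) \<Longrightarrow> mon_eval f m = mon_eval g m"
  by (auto simp: mon_eval_def intro: prod.cong)

definition var :: "'v \<Rightarrow> ('v \<Rightarrow>\<^sub>0 nat) \<Rightarrow>\<^sub>0 'k::comm_ring_1" where
  "var v = Poly_Mapping.single (Poly_Mapping.single v 1) 1"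

lemma mvar_eq_var: "mvar = var"
  by (simp add: fun_eq_iff mvar_def var_def)

definition subst :: "('v \<Rightarrow> ('w \<Rightarrow>\<^sub>0 nat) \<Rightarrow>\<^sub>0 'k::comm_ring_1) \<Rightarrow> (('v \<Rightarrow>\<^sub>0 nat) \<Rightarrow>\<^sub>0 'k) \<Rightarrow> ('w \<Rightarrow>\<^sub>0 nat) \<Rightarrow>\<^sub>0 'k"
  where "subst f = lext cst (mon_eval f)"

lemma mpoly_eval_eq_subst: "mpoly_eval = subst"
  by (simp add: fun_eq_iff mpoly_eval_def subst_def lext_def mon_eval_def mconst_eq_cst)

lemma subst_0 [simp]: "subst f 0 = 0"
  and subst_single: "subst f (Poly_Mapping.single m a) = cst a * mon_eval f m"
  and subst_add: "subst f (p + q) = subst f p + subst f q"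
  and subst_diff: "subst f (p - q) = subst f p - subst f q"
  and subst_sum: "subst f (\<Sum>x\<in>S. g x) = (\<Sum>x\<in>S. subst f (g x))"
  and subst_mult: "subst f (p * q) = subst f p * subst f q"
  by (simp_all add: subst_def cst.lext_0 cst.lext_single cst.lext_add cst.lext_diff cst.lext_sum
      cst.lext_mult mon_eval_add)

lemma subst_cst [simp]: "subst f (cst a) = cst a"
  by (subst cst_def) (simp add: subst_single)

lemma subst_1 [simp]: "subst f 1 = 1"
  using subst_cst[of f 1] by (simp add: cst.c_1)

lemma subst_var [simp]: "subst f (var v) = f v"
  by (simp add: var_def subst_single mon_eval_single cst.c_1)

lemma subst_power: "subst f (p ^ a) = subst f p ^ a"
  by (induction a) (auto simp: subst_mult)

lemma subst_prod: "subst f (\<Prod>x\<in>S. g x) = (\<Prod>x\<in>S. subst f (g x))"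
  by (induction S rule: infinite_finite_induct) (auto simp: subst_mult)

lemma subst_mon_eval: "subst g (mon_eval f m) = mon_eval (\<lambda>v. subst g (f v)) m"
  by (simp add: mon_eval_def subst_prod subst_power)

lemma subst_subst: "subst g (subst f p) = subst (\<lambda>v. subst g (f v)) p"
  by (induction p rule: poly_mapping_single_induct)
     (auto simp: subst_add subst_single subst_mult subst_mon_eval)

lemma single_sum_exponent: "(\<Prod>x\<in>S. Poly_Mapping.single (g x) (1::'k::comm_ring_1)) = Poly_Mapping.single (\<Sum>x\<in>S. g x) 1"
  by (induction S rule: infinite_finite_induct) (auto simp: mult_single)

lemma var_power: "var v ^ a = Poly_Mapping.single (Poly_Mapping.single v a) 1"
  by (induction a) (auto simp: var_def mult_single simp flip: single_add)

subsection \<open>Variables occurring in a polynomial\<close>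

definition in_vars :: "'v set \<Rightarrow> (('v \<Rightarrow>\<^sub>0 nat) \<Rightarrow>\<^sub>0 'k::comm_ring_1) \<Rightarrow> bool" where
  "in_vars A p \<longleftrightarrow> (\<forall>m\<in>Poly_Mapping.keys p. Poly_Mapping.keys m \<subseteq> A)"

lemma poly_ring_eq: "poly_ring n = {p. in_vars {..<n} p}"
  by (simp add: poly_ring_def in_vars_def)

lemma in_vars_mono: "in_vars A p \<Longrightarrow> A \<subseteq> B \<Longrightarrow> in_vars B p"
  by (auto simp: in_vars_def)

lemma in_vars_0 [simp]: "in_vars A 0"
  by (simp add: in_vars_def)

lemma in_vars_1 [simp]: "in_vars A 1"
  by (simp add: in_vars_def)

lemma in_vars_cst [simp]: "in_vars A (cst a)"
  by (simp add: in_vars_def cst_def)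

lemma in_vars_single: "Poly_Mapping.keys m \<subseteq> A \<Longrightarrow> in_vars A (Poly_Mapping.single m a)"
  by (simp add: in_vars_def)

lemma in_vars_var: "v \<in> A \<Longrightarrow> in_vars A (var v)"
  by (simp add: in_vars_def var_def)

lemma in_vars_add: "in_vars A p \<Longrightarrow> in_vars A q \<Longrightarrow> in_vars A (p + q)"
  using keys_add[of p q] by (auto simp: in_vars_def)

lemma in_vars_uminus: "in_vars A p \<Longrightarrow> in_vars A (- p)"
  by (auto simp: in_vars_def in_keys_iff)

lemma in_vars_diff: "in_vars A p \<Longrightarrow> in_vars A q \<Longrightarrow> in_vars A (p - q)"
  using in_vars_add[OF _ in_vars_uminus, of A p q] by simp

lemma in_vars_mult: "in_vars A p \<Longrightarrow> in_vars A q \<Longrightarrow> in_vars A (p * q)"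
  using keys_mult[of p q] by (fastforce simp: in_vars_def keys_add_nat)

lemma in_vars_sum: "(\<And>x. x \<in> S \<Longrightarrow> in_vars A (f x)) \<Longrightarrow> in_vars A (\<Sum>x\<in>S. f x)"
  by (induction S rule: infinite_finite_induct) (auto simp: in_vars_add)

lemma in_vars_prod: "(\<And>x. x \<in> S \<Longrightarrow> in_vars A (f x)) \<Longrightarrow> in_vars A (\<Prod>x\<in>S. f x)"
  by (induction S rule: infinite_finite_induct) (auto simp: in_vars_mult)

lemma in_vars_power: "in_vars A p \<Longrightarrow> in_vars A (p ^ a)"
  by (induction a) (auto simp: in_vars_mult)

lemma in_vars_lext:
  "(\<And>m. m \<in> Poly_Mapping.keys p \<Longrightarrow> in_vars A (h m)) \<Longrightarrow> in_vars A (lext cst h p)"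
  by (auto simp: lext_def intro!: in_vars_sum in_vars_mult)

lemma in_vars_subst:
  "in_vars A p \<Longrightarrow> (\<And>v. v \<in> A \<Longrightarrow> in_vars B (f v)) \<Longrightarrow> in_vars B (subst f p)"
  unfolding subst_def mon_eval_def
  by (intro in_vars_lext in_vars_prod in_vars_power) (unfold in_vars_def, blast)

lemma subst_cong:
  assumes "in_vars A p" "\<And>v. v \<in> A \<Longrightarrow> f v = g v"
  shows "subst f p = subst g p"
  unfolding subst_def using assms
  by (intro lext_cong mon_eval_cong) (auto simp: in_vars_def subset_iff)

subsection \<open>Renaming variables\<close>

definition mon_rename :: "('v \<Rightarrow> 'w) \<Rightarrow> ('v \<Rightarrow>\<^sub>0 nat) \<Rightarrow> ('w \<Rightarrow>\<^sub>0 nat)" where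
  "mon_rename g m = (\<Sum>v\<in>Poly_Mapping.keys m. Poly_Mapping.single (g v) (Poly_Mapping.lookup m v))"

definition rename :: "('v \<Rightarrow> 'w) \<Rightarrow> (('v \<Rightarrow>\<^sub>0 nat) \<Rightarrow>\<^sub>0 'k::comm_ring_1) \<Rightarrow> ('w \<Rightarrow>\<^sub>0 nat) \<Rightarrow>\<^sub>0 'k" where
  "rename g = subst (\<lambda>v. var (g v))"

lemma mon_eval_rename: "mon_eval (\<lambda>v. var (g v)) m = Poly_Mapping.single (mon_rename g m) 1"
  by (simp add: mon_eval_def var_power mon_rename_def single_sum_exponent)

lemma rename_single: "rename g (Poly_Mapping.single m a) = Poly_Mapping.single (mon_rename g m) a"
  by (simp add: rename_def subst_single mon_eval_rename cst_mult_single)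

lemma rename_0 [simp]: "rename g 0 = 0"
  and rename_cst [simp]: "rename g (cst a) = cst a"
  and rename_add: "rename g (p + q) = rename g p + rename g q"
  and rename_diff: "rename g (p - q) = rename g p - rename g q"
  and rename_sum: "rename g (\<Sum>x\<in>S. f x) = (\<Sum>x\<in>S. rename g (f x))"
  and rename_mult: "rename g (p * q) = rename g p * rename g q"
  and rename_prod: "rename g (\<Prod>x\<in>S. f x) = (\<Prod>x\<in>S. rename g (f x))"
  by (simp_all add: rename_def subst_add subst_diff subst_sum subst_mult subst_prod)

lemma (in coeff_hom) lext_rename: "lext c h (rename g p) = lext c (\<lambda>m. h (mon_rename g m)) p"
  by (induction p rule: poly_mapping_single_induct)
     (auto simp: rename_single lext_single lext_add rename_add)

lemma keys_rename: "Poly_Mapping.keys (rename g p) \<subseteq> mon_rename g ` Poly_Mapping.keys p"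
proof -
  have "rename g p = (\<Sum>m\<in>Poly_Mapping.keys p. Poly_Mapping.single (mon_rename g m) (Poly_Mapping.lookup p m))"
    by (subst (1) poly_mapping_expand) (simp add: rename_def subst_sum flip: rename_single)
  thus ?thesis using keys_sum_subset by (fastforce split: if_splits)
qed

lemma lookup_mon_rename:
  "Poly_Mapping.lookup (mon_rename g m) w = (\<Sum>v\<in>{v\<in>Poly_Mapping.keys m. g v = w}. Poly_Mapping.lookup m v)"
proof -
  have "Poly_Mapping.lookup (mon_rename g m) w =
      (\<Sum>v\<in>Poly_Mapping.keys m. if g v = w then Poly_Mapping.lookup m v else 0)"
    by (auto simp: mon_rename_def lookup_sum lookup_single when_def)
  thus ?thesis by (simp add: sum.If_cases Int_def)
qed

lemma lookup_mon_rename_inj: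
  assumes "inj g"
  shows "Poly_Mapping.lookup (mon_rename g m) (g v) = Poly_Mapping.lookup m v"
proof -
  have "{u\<in>Poly_Mapping.keys m. g u = g v} = (if v \<in> Poly_Mapping.keys m then {v} else {})"
    using assms by (auto dest: injD)
  thus ?thesis by (auto simp: lookup_mon_rename in_keys_iff)
qed

lemma lookup_mon_rename_notin: "w \<notin> range g \<Longrightarrow> Poly_Mapping.lookup (mon_rename g m) w = 0"
  by (auto simp: lookup_mon_rename intro!: sum.neutral)

lemma lookup_rename_inj:
  assumes "inj g"
  shows "Poly_Mapping.lookup (rename g p) (mon_rename g m) = Poly_Mapping.lookup p m"
proof (induction p rule: poly_mapping_single_induct)
  case (single m' a)
  have "mon_rename g m' = mon_rename g m \<longleftrightarrow> m' = m"
    using lookup_mon_rename_inj[OF assms] by (metis poly_mapping_eqI)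
  thus ?case by (simp add: rename_single lookup_single when_def)
next
  case (add p q)
  then show ?case by (simp add: rename_def subst_add lookup_add)
qed

lemma rename_rename: "rename g (rename f p) = rename (g \<circ> f) p"
  by (simp add: rename_def subst_subst)

lemma keys_mon_rename: "Poly_Mapping.keys (mon_rename g m) \<subseteq> g ` Poly_Mapping.keys m"
  using keys_sum_subset by (fastforce simp: mon_rename_def split: if_splits)

lemma in_vars_rename: "in_vars A p \<Longrightarrow> g ` A \<subseteq> B \<Longrightarrow> in_vars B (rename g p)"
  unfolding rename_def by (rule in_vars_subst) (auto intro: in_vars_var)

subsection \<open>Doubly indexed variables\<close>

text \<open>A variable \<open>(i, j)\<close> is coordinate \<open>j\<close> of the copy of V with
  index \<open>i\<close>; a row is the part of a monomial that lives on one copy.\<close>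

definition row :: "'i \<Rightarrow> ('i \<times> 'j \<Rightarrow>\<^sub>0 nat) \<Rightarrow> 'j \<Rightarrow>\<^sub>0 nat" where
  "row i m = Poly_Mapping.map_key (Pair i) m"

lemma lookup_row [simp]: "Poly_Mapping.lookup (row i m) j = Poly_Mapping.lookup m (i, j)"
  by (simp add: row_def map_key.rep_eq inj_def)

lemma row_add [simp]: "row i (m + m') = row i m + row i m'"
  by (rule poly_mapping_eqI) (simp add: lookup_add)

lemma row_0 [simp]: "row i 0 = 0"
  by (rule poly_mapping_eqI) simp

lemma row_eqI: "(\<And>i. row i m = row i m') \<Longrightarrow> m = m'"
  by (rule poly_mapping_eqI) (metis lookup_row surj_pair)

lemma row_mon_rename_Pair: "row l (mon_rename (Pair l') m) = (if l = l' then m else 0)"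
  by (rule poly_mapping_eqI) (auto simp: lookup_mon_rename_inj inj_def intro!: lookup_mon_rename_notin)

lemma keys_row_eq: "Poly_Mapping.keys (row i m) = {j. (i, j) \<in> Poly_Mapping.keys m}"
  by (simp add: set_eq_iff in_keys_iff)

lemma row_eq_0: "Poly_Mapping.keys m \<subseteq> A \<times> B \<Longrightarrow> i \<notin> A \<Longrightarrow> row i m = 0"
  by (rule poly_mapping_eqI) (auto simp flip: not_in_keys_iff_lookup_eq_zero)

lemma keys_row: "Poly_Mapping.keys m \<subseteq> A \<times> B \<Longrightarrow> Poly_Mapping.keys (row i m) \<subseteq> B"
  by (auto simp: keys_row_eq)

definition slot :: "'i \<Rightarrow> (('j \<Rightarrow>\<^sub>0 nat) \<Rightarrow>\<^sub>0 'k::comm_ring_1) \<Rightarrow> ('i \<times> 'j \<Rightarrow>\<^sub>0 nat) \<Rightarrow>\<^sub>0 'k" where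
  "slot l = rename (Pair l)"

text \<open>The value at \<open>F\<close> of the tensor product of \<open>r\<close> functionals,
  each recorded by its values on monomials.\<close>

definition tensor_app :: "nat \<Rightarrow> (nat \<Rightarrow> ('j \<Rightarrow>\<^sub>0 nat) \<Rightarrow> 'k) \<Rightarrow> ((nat \<times> 'j \<Rightarrow>\<^sub>0 nat) \<Rightarrow>\<^sub>0 'k::comm_ring_1) \<Rightarrow> 'k" where
  "tensor_app r \<Lambda> F = lext (\<lambda>x. x) (\<lambda>m. \<Prod>l<r. \<Lambda> l (row l m)) F"

definition annihilator :: "('m \<Rightarrow>\<^sub>0 'k::comm_ring_1) set \<Rightarrow> ('m \<Rightarrow> 'k) set" where
  "annihilator I = {\<mu>. \<forall>p\<in>I. lext (\<lambda>x. x) \<mu> p = 0}"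

text \<open>The ideal generated by the \<open>r\<close> copies of \<open>I\<close>, encoded by duality: it is the common kernel of the
  tensor products of functionals that vanish on \<open>I\<close>. Rows with index at least \<open>r\<close> are ignored.\<close>

definition tensor_ideal :: "'k::comm_ring_1 mpoly set \<Rightarrow> nat \<Rightarrow> ((nat \<times> nat \<Rightarrow>\<^sub>0 nat) \<Rightarrow>\<^sub>0 'k) set" where
  "tensor_ideal I r = {F. \<forall>\<Lambda>. (\<forall>l<r. \<Lambda> l \<in> annihilator I) \<longrightarrow> tensor_app r \<Lambda> F = 0}"

section \<open>Powers of the join as kernels\<close>

text \<open>Extend a basis of \<open>S\<close> by \<open>p\<close>, and prescribe 1 on
  \<open>p\<close> and 0 on that basis. This is what makes the encoding of ideals by functionals
  faithful.\<close>

lemma separating_functional: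
  fixes S :: "(('v \<Rightarrow>\<^sub>0 nat) \<Rightarrow>\<^sub>0 'k::field) set"
  assumes S: "0 \<in> S" "\<And>p q. p \<in> S \<Longrightarrow> q \<in> S \<Longrightarrow> p + q \<in> S" "\<And>a p. p \<in> S \<Longrightarrow> cst a * p \<in> S"
    and p: "p \<notin> S"
  shows "\<exists>\<mu>\<in>annihilator S. lext (\<lambda>x. x) \<mu> p = 1"
proof -
  let ?sc = "\<lambda>a (p :: ('v \<Rightarrow>\<^sub>0 nat) \<Rightarrow>\<^sub>0 'k). cst a * p"
  interpret vs: vector_space ?sc
    by unfold_locales (auto simp: cst.c_add cst.c_mult cst.c_1 algebra_simps)
  interpret fs: vector_space "(*) :: 'k \<Rightarrow> 'k \<Rightarrow> 'k"
    by unfold_locales (auto simp: algebra_simps)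
  interpret pair: vector_space_pair ?sc "(*) :: 'k \<Rightarrow> 'k \<Rightarrow> 'k"
    by unfold_locales
  have sub: "vs.subspace S" using S by (auto simp: vs.subspace_def)
  obtain B where B: "B \<subseteq> S" "vs.independent B" "S \<subseteq> vs.span B"
    using vs.maximal_independent_subset[of S] by blast
  have "vs.span B \<subseteq> S" using B(1) sub by (simp add: vs.span_minimal)
  hence "p \<notin> vs.span B" using p by blast
  hence ind: "vs.independent (insert p B)" using B(2) by (simp add: vs.independent_insert)
  obtain g where g: "Vector_Spaces.linear ?sc (*) g" "\<And>x. x \<in> insert p B \<Longrightarrow> g x = (if x = p then 1 else 0)"
    using pair.linear_independent_extend[OF ind, of "\<lambda>x. if x = p then 1 else 0"] by blast
  interpret g: Vector_Spaces.linear ?sc "(*)" g by (rule g(1))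
  have g0: "g x = 0" if "x \<in> S" for x
  proof (rule pair.linear_eq_0_on_span[OF g(1)])
    show "x \<in> vs.span B" using that B by blast
    show "g y = 0" if "y \<in> B" for y using that g(2) B(1) p by auto
  qed
  define \<mu> where "\<mu> m = g (Poly_Mapping.single m 1)" for m
  have ext: "lext (\<lambda>x. x) \<mu> q = g q" for q
  proof (induction q rule: poly_mapping_single_induct)
    case (single m a)
    then show ?case using g.scale[of a "Poly_Mapping.single m 1"]
      by (simp add: scal.lext_single \<mu>_def cst_mult_single)
  next
    case (add p q)
    then show ?case by (simp add: scal.lext_add g.add)
  qed
  show ?thesis by (rule bexI[of _ \<mu>]) (auto simp: annihilator_def ext g0 g(2))
qed

section \<open>Tensor products of functionals and their common kernel\<close>

lemma tensor_app_0 [simp]: "tensor_app r \<Lambda> 0 = 0"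
  and tensor_app_add: "tensor_app r \<Lambda> (F + G) = tensor_app r \<Lambda> F + tensor_app r \<Lambda> G"
  and tensor_app_diff: "tensor_app r \<Lambda> (F - G) = tensor_app r \<Lambda> F - tensor_app r \<Lambda> G"
  and tensor_app_sum: "tensor_app r \<Lambda> (\<Sum>x\<in>S. f x) = (\<Sum>x\<in>S. tensor_app r \<Lambda> (f x))"
  and tensor_app_cst_mult: "tensor_app r \<Lambda> (cst a * F) = a * tensor_app r \<Lambda> F"
  by (simp_all add: tensor_app_def scal.lext_0 scal.lext_single scal.lext_add scal.lext_diff
      scal.lext_sum scal.lext_cst_mult)

lemma keys_slot: "m \<in> Poly_Mapping.keys (slot l f) \<Longrightarrow> \<exists>m'\<in>Poly_Mapping.keys f. m = mon_rename (Pair l) m'"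
  using keys_rename by (fastforce simp: slot_def)

lemma slot_0 [simp]: "slot l 0 = 0"
  and slot_1 [simp]: "slot l 1 = 1"
  and slot_sum: "slot l (\<Sum>x\<in>S. h x) = (\<Sum>x\<in>S. slot l (h x))"
  and slot_mult: "slot l (f * g) = slot l f * slot l g"
  and slot_subst: "slot l (subst b q) = subst (\<lambda>j. slot l (b j)) q"
  by (simp_all add: slot_def rename_def subst_add subst_sum subst_mult subst_subst)

lemma in_vars_slot: "in_vars B f \<Longrightarrow> l \<in> A \<Longrightarrow> in_vars (A \<times> B) (slot l f)"
  unfolding slot_def by (rule in_vars_rename) auto

text \<open>The two factors occupy disjoint rows, so the product of functionals splits
  accordingly.\<close>

lemma tensor_app_slot_mult:
  assumes "in_vars ({..<r} \<times> UNIV) G"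
  shows "tensor_app (Suc r) \<Lambda> (slot r f * G) = lext (\<lambda>x. x) (\<Lambda> r) f * tensor_app r \<Lambda> G"
proof -
  have "tensor_app (Suc r) \<Lambda> (slot r f * G) =
      lext (\<lambda>x. x) (\<lambda>m. \<Lambda> r (row r m)) (slot r f) * lext (\<lambda>x. x) (\<lambda>m. \<Prod>l<r. \<Lambda> l (row l m)) G"
    unfolding tensor_app_def
  proof (rule scal.lext_mult)
    fix m m' assume m: "m \<in> Poly_Mapping.keys (slot r f)" and m': "m' \<in> Poly_Mapping.keys G"
    obtain m'' where "m = mon_rename (Pair r) m''" using keys_slot[OF m] by blast
    moreover have "row r m' = 0" using assms m' row_eq_0[of m' "{..<r}" UNIV r] by (auto simp: in_vars_def)
    ultimately show "(\<Prod>l<Suc r. \<Lambda> l (row l (m + m'))) = \<Lambda> r (row r m) * (\<Prod>l<r. \<Lambda> l (row l m'))"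
      by (simp add: row_mon_rename_Pair mult.commute)
  qed
  thus ?thesis by (simp add: tensor_app_def slot_def scal.lext_rename row_mon_rename_Pair)
qed

text \<open>In every other row the monomial is 1, whence the constants
  \<open>\<Lambda> l' 0\<close>.\<close>

lemma tensor_app_slot:
  assumes "l < r"
  shows "tensor_app r \<Lambda> (slot l f) = lext (\<lambda>x. x) (\<Lambda> l) f * (\<Prod>l'\<in>{..<r} - {l}. \<Lambda> l' 0)"
proof -
  have "(\<Prod>l'<r. \<Lambda> l' (row l' (mon_rename (Pair l) m))) = \<Lambda> l m * (\<Prod>l'\<in>{..<r} - {l}. \<Lambda> l' 0)" for m
    using assms by (subst prod.remove[of _ l]) (auto simp: row_mon_rename_Pair intro!: prod.cong)
  thus ?thesis
    by (simp add: tensor_app_def slot_def scal.lext_rename)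
       (simp add: lext_def sum_distrib_right mult.assoc)
qed

lemma tensor_idealD: "F \<in> tensor_ideal I r \<Longrightarrow> (\<And>l. l < r \<Longrightarrow> \<Lambda> l \<in> annihilator I) \<Longrightarrow> tensor_app r \<Lambda> F = 0"
  by (simp add: tensor_ideal_def)

lemma tensor_ideal_0 [simp]: "0 \<in> tensor_ideal I r"
  and tensor_ideal_add: "F \<in> tensor_ideal I r \<Longrightarrow> G \<in> tensor_ideal I r \<Longrightarrow> F + G \<in> tensor_ideal I r"
  and tensor_ideal_diff: "F \<in> tensor_ideal I r \<Longrightarrow> G \<in> tensor_ideal I r \<Longrightarrow> F - G \<in> tensor_ideal I r"
  and tensor_ideal_cst_mult: "F \<in> tensor_ideal I r \<Longrightarrow> cst a * F \<in> tensor_ideal I r"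
  by (simp_all add: tensor_ideal_def tensor_app_add tensor_app_diff tensor_app_cst_mult)

lemma tensor_ideal_sum: "(\<And>x. x \<in> S \<Longrightarrow> f x \<in> tensor_ideal I r) \<Longrightarrow> (\<Sum>x\<in>S. f x) \<in> tensor_ideal I r"
  by (induction S rule: infinite_finite_induct) (auto intro: tensor_ideal_add)

lemma slot_in_tensor_ideal: "f \<in> I \<Longrightarrow> l < r \<Longrightarrow> slot l f \<in> tensor_ideal I r"
  by (simp add: tensor_ideal_def tensor_app_slot annihilator_def)

text \<open>Row \<open>r\<close> does not occur in \<open>F\<close>, so the additional functional
  contributes only a scalar factor.\<close>

lemma tensor_ideal_Suc:
  assumes "F \<in> tensor_ideal I r" "in_vars ({..<r} \<times> UNIV) F"
  shows "F \<in> tensor_ideal I (Suc r)"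
  unfolding tensor_ideal_def
proof (intro CollectI allI impI)
  fix \<Lambda> assume "\<forall>l<Suc r. \<Lambda> l \<in> annihilator I"
  hence "tensor_app r \<Lambda> F = 0" using assms(1) by (intro tensor_idealD) auto
  thus "tensor_app (Suc r) \<Lambda> F = 0"
    using tensor_app_slot_mult[OF assms(2), of \<Lambda> 1] by simp
qed

text \<open>Multiplication by a monomial \<open>m\<close> can be moved to the functionals:
  \<open>\<Lambda>' l\<close> is \<open>\<Lambda> l\<close> precomposed with multiplication by row
  \<open>l\<close> of \<open>m\<close>, and it still vanishes on \<open>I\<close> because
  \<open>I\<close> is an ideal.\<close>

lemma tensor_ideal_mult:
  assumes I: "is_ideal_in (poly_ring n) I"
    and F: "F \<in> tensor_ideal I r" and u: "in_vars (UNIV \<times> {..<n}) u"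
  shows "u * F \<in> tensor_ideal I r"
proof -
  have *: "Poly_Mapping.single m a * F \<in> tensor_ideal I r" if m: "m \<in> Poly_Mapping.keys u" for m a
    unfolding tensor_ideal_def
  proof (intro CollectI allI impI)
    fix \<Lambda> assume \<Lambda>: "\<forall>l<r. \<Lambda> l \<in> annihilator I"
    define \<Lambda>' where "\<Lambda>' l m' = \<Lambda> l (row l m + m')" for l m'
    have "tensor_app r \<Lambda> (Poly_Mapping.single m a * F) =
      lext (\<lambda>x. x) (\<lambda>_. 1) (Poly_Mapping.single m a) * lext (\<lambda>x. x) (\<lambda>m. \<Prod>l<r. \<Lambda>' l (row l m)) F"
      unfolding tensor_app_def
      by (rule scal.lext_mult) (auto simp: \<Lambda>'_def split: if_splits)
    also have "lext (\<lambda>x. x) (\<lambda>m. \<Prod>l<r. \<Lambda>' l (row l m)) F = tensor_app r \<Lambda>' F"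
      by (simp add: tensor_app_def)
    also have "tensor_app r \<Lambda>' F = 0"
    proof (rule tensor_idealD[OF F])
      fix l assume "l < r"
      have "lext (\<lambda>x. x) (\<Lambda>' l) p = 0" if p: "p \<in> I" for p
      proof -
        have "Poly_Mapping.keys (row l m) \<subseteq> {..<n}" using u m by (intro keys_row[of _ UNIV]) (simp add: in_vars_def)
        hence "Poly_Mapping.single (row l m) 1 \<in> poly_ring n" by (simp add: poly_ring_def)
        hence "Poly_Mapping.single (row l m) 1 * p \<in> I" using I p by (auto simp: is_ideal_in_def)
        hence "lext (\<lambda>x. x) (\<Lambda> l) (Poly_Mapping.single (row l m) 1 * p) = 0"
          using \<Lambda> \<open>l < r\<close> by (auto simp: annihilator_def)
        moreover have "lext (\<lambda>x. x) (\<Lambda> l) (Poly_Mapping.single (row l m) 1 * p) =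
            lext (\<lambda>x. x) (\<lambda>_. 1) (Poly_Mapping.single (row l m) 1) * lext (\<lambda>x. x) (\<Lambda>' l) p"
          by (rule scal.lext_mult) (auto simp: \<Lambda>'_def split: if_splits)
        ultimately show ?thesis by (simp add: scal.lext_single)
      qed
      thus "\<Lambda>' l \<in> annihilator I" by (simp add: annihilator_def)
    qed
    finally show "tensor_app r \<Lambda> (Poly_Mapping.single m a * F) = 0" by simp
  qed
  have "u * F = (\<Sum>m\<in>Poly_Mapping.keys u. Poly_Mapping.single m (Poly_Mapping.lookup u m)) * F"
    by (simp flip: poly_mapping_expand)
  thus ?thesis by (auto simp: sum_distrib_right intro!: tensor_ideal_sum *)
qed

section \<open>Generated ideals and the kernel of the join\<close>

lemma ideal_gen_0: "0 \<in> ideal_gen R S"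
  unfolding ideal_gen_def by (intro CollectI exI[of _ "{}"]) auto

lemma ideal_gen_gen: "s \<in> S \<Longrightarrow> q \<in> R \<Longrightarrow> q * s \<in> ideal_gen R S"
  unfolding ideal_gen_def by (intro CollectI exI[of _ "{s}"] exI[of _ "\<lambda>_. q"]) auto

lemma ideal_gen_add:
  assumes "p \<in> ideal_gen (poly_ring n) S" "q \<in> ideal_gen (poly_ring n) S"
  shows "p + q \<in> ideal_gen (poly_ring n) S"
proof -
  obtain F c G d where p: "p = (\<Sum>s\<in>F. c s * s)" "finite F" "F \<subseteq> S" "\<forall>s\<in>F. c s \<in> poly_ring n"
    and q: "q = (\<Sum>s\<in>G. d s * s)" "finite G" "G \<subseteq> S" "\<forall>s\<in>G. d s \<in> poly_ring n"
    using assms by (auto simp: ideal_gen_def)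
  define c' where "c' s = (if s \<in> F then c s else 0)" for s
  define d' where "d' s = (if s \<in> G then d s else 0)" for s
  have "p = (\<Sum>s\<in>F \<union> G. c' s * s)" unfolding p(1)
    by (rule sum.mono_neutral_cong_left) (use p q in \<open>auto simp: c'_def\<close>)
  moreover have "q = (\<Sum>s\<in>F \<union> G. d' s * s)" unfolding q(1)
    by (rule sum.mono_neutral_cong_left) (use p q in \<open>auto simp: d'_def\<close>)
  ultimately have "p + q = (\<Sum>s\<in>F \<union> G. (c' s + d' s) * s)"
    by (simp add: distrib_right sum.distrib)
  moreover have "\<forall>s\<in>F \<union> G. c' s + d' s \<in> poly_ring n"
    using p q by (auto simp: c'_def d'_def poly_ring_eq intro!: in_vars_add)
  ultimately show ?thesis using p q unfolding ideal_gen_def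
    by (intro CollectI exI[of _ "F \<union> G"] exI[of _ "\<lambda>s. c' s + d' s"]) auto
qed

lemma ideal_gen_sum:
  "(\<And>x. x \<in> A \<Longrightarrow> f x \<in> ideal_gen (poly_ring n) S) \<Longrightarrow> (\<Sum>x\<in>A. f x) \<in> ideal_gen (poly_ring n) S"
  by (induction A rule: infinite_finite_induct) (auto simp: ideal_gen_0 ideal_gen_add)

definition secant_map :: "nat \<Rightarrow> (nat \<Rightarrow> 'k::comm_ring_1 mpoly) \<Rightarrow> 'k mpoly \<Rightarrow> (nat \<times> nat \<Rightarrow>\<^sub>0 nat) \<Rightarrow>\<^sub>0 'k" where
  "secant_map r b = subst (\<lambda>j. \<Sum>l<r. slot l (b j))"

lemma in_vars_secant_map:
  assumes "q \<in> poly_ring N" "\<And>j. j < N \<Longrightarrow> b j \<in> poly_ring n"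
  shows "in_vars ({..<r} \<times> {..<n}) (secant_map r b q)"
  unfolding secant_map_def
  by (rule in_vars_subst[of "{..<N}"])
     (use assms in \<open>auto simp: poly_ring_eq intro!: in_vars_sum in_vars_slot\<close>)

text \<open>Presents elements of the ring in \<open>2 * N\<close> variables as finite sums of pure
  tensors.\<close>

lemma poly_ring_split_monomial:
  fixes a :: "'a::comm_ring_1"
  assumes "Poly_Mapping.keys m \<subseteq> {..<2 * N}"
  shows "\<exists>f\<in>poly_ring N. \<exists>g\<in>poly_ring N. Poly_Mapping.single m a = f * rename ((+) N) g"
proof -
  let ?e = "Poly_Mapping.lookup m" and ?K = "Poly_Mapping.keys m"
  define f where "f = cst a * (\<Prod>v\<in>?K \<inter> {..<N}. var v ^ ?e v)"
  define g :: "'a mpoly" where "g = (\<Prod>v\<in>?K - {..<N}. var (v - N) ^ ?e v)"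
  have "rename ((+) N) g = (\<Prod>v\<in>?K - {..<N}. var v ^ ?e v)"
    by (auto simp: g_def rename_def subst_prod subst_power intro!: prod.cong)
  hence "f * rename ((+) N) g = cst a * (\<Prod>v\<in>?K. var v ^ ?e v)"
    using prod.Int_Diff[of ?K "\<lambda>v. var v ^ ?e v :: 'a mpoly" "{..<N}"] by (simp add: f_def mult.assoc)
  also have "\<dots> = Poly_Mapping.single m a"
    by (simp add: var_power single_sum_exponent cst_mult_single flip: poly_mapping_expand)
  finally have "Poly_Mapping.single m a = f * rename ((+) N) g" by simp
  moreover have "f \<in> poly_ring N" "g \<in> poly_ring N"
    using assms by (auto simp: f_def g_def poly_ring_eq subset_iff
        intro!: in_vars_mult in_vars_prod in_vars_power in_vars_var)
  ultimately show ?thesis by blast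
qed

context
  fixes n N :: nat and I :: "'k::field mpoly set" and b :: "nat \<Rightarrow> 'k mpoly"
  assumes I: "is_ideal_in (poly_ring n) I" and b: "\<And>j. j < N \<Longrightarrow> b j \<in> poly_ring n"
begin

text \<open>The kernel of a tensor product of injective maps vanishes: if the classes of the first tensor
  factors are dependent one summand can be eliminated, otherwise a separating functional isolates
  one of the second factors.\<close>

lemma join_kernel_finite_sum:
  fixes r
  defines "E \<equiv> subst (\<lambda>v. if v < N then slot r (b v) else \<Sum>l<r. slot l (b (v - N)))"
    and "J \<equiv> veronese_ideal I N b"
    and "J' \<equiv> {q \<in> poly_ring N. secant_map r b q \<in> tensor_ideal I r}"
  assumes "finite S" "\<And>t. t \<in> S \<Longrightarrow> f t \<in> poly_ring N" "\<And>t. t \<in> S \<Longrightarrow> g t \<in> poly_ring N"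
    and "E (\<Sum>t\<in>S. f t * rename ((+) N) (g t)) \<in> tensor_ideal I (Suc r)"
  shows "(\<Sum>t\<in>S. f t * rename ((+) N) (g t)) \<in>
     ideal_gen (poly_ring (2 * N)) (J \<union> rename ((+) N) ` J')"
  using assms(4-7)
\<comment> \<open>Eliminating the summand \<open>s\<close> may alter the second factors of the
  others, so \<open>g\<close> has to vary.\<close>
proof (induction arbitrary: g rule: finite_induct)
  case empty
  then show ?case by (simp add: ideal_gen_0)
next
  case (insert s S)
  let ?G = "ideal_gen (poly_ring (2 * N)) (J \<union> rename ((+) N) ` J')"
  let ?sh = "rename ((+) N) :: 'k mpoly \<Rightarrow> 'k mpoly"
  have E_diff: "E (p - q) = E p - E q" and E_mult: "E (p * q) = E p * E q"
    and E_sum: "E (\<Sum>x\<in>A. h x) = (\<Sum>x\<in>A. E (h x))" for p q and h :: "'x \<Rightarrow> 'k mpoly" and A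
    by (simp_all add: E_def subst_diff subst_mult subst_sum)
  have E_f: "E p = slot r (subst b p)" if "p \<in> poly_ring N" for p
    using that unfolding E_def slot_subst by (intro subst_cong[of "{..<N}"]) (auto simp: poly_ring_eq)
  have E_g: "E (?sh p) = secant_map r b p" if "p \<in> poly_ring N" for p
    using that unfolding E_def secant_map_def rename_def by (simp add: subst_subst)
  have sh: "?sh p \<in> poly_ring (2 * N)" if "p \<in> poly_ring N" for p
    using that unfolding poly_ring_eq by (auto intro: in_vars_rename)
  have le: "p \<in> poly_ring (2 * N)" if "p \<in> poly_ring N" for p
    using that unfolding poly_ring_eq by (auto intro: in_vars_mono)
  have subst_b: "subst b p \<in> poly_ring n" if "p \<in> poly_ring N" for p
    using that b by (auto simp: poly_ring_eq intro: in_vars_subst)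
  have sec_vars: "in_vars ({..<r} \<times> UNIV) (secant_map r b p)" if "p \<in> poly_ring N" for p
    using in_vars_secant_map[OF that b] by (rule in_vars_mono) auto
  have sec_vars': "in_vars (UNIV \<times> {..<n}) (secant_map r b p)" if "p \<in> poly_ring N" for p
    using in_vars_secant_map[OF that b] by (rule in_vars_mono) auto
  have fs: "f s \<in> poly_ring N" "g s \<in> poly_ring N" using insert.prems by auto
  show ?case
  proof (cases "\<exists>c. \<exists>i\<in>I. subst b (f s) = i + (\<Sum>t\<in>S. cst (c t) * subst b (f t))")
    case True
    then obtain c i where ci: "i \<in> I" "subst b (f s) = i + (\<Sum>t\<in>S. cst (c t) * subst b (f t))" by blast
    \<comment> \<open>Removing the linear dependence leaves \<open>f'\<close> in the first ideal
      \<open>J\<close>; what is removed is absorbed by replacing each \<open>g t\<close> by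
      \<open>g t + cst (c t) * g s\<close>.\<close>
    define f' where "f' = f s - (\<Sum>t\<in>S. cst (c t) * f t)"
    have f': "f' \<in> poly_ring N"
      using insert.prems by (auto simp: f'_def poly_ring_eq intro!: in_vars_diff in_vars_sum in_vars_mult)
    have "subst b f' = i" using ci by (simp add: f'_def subst_diff subst_sum subst_mult)
    hence "f' \<in> J" using f' ci by (simp add: J_def veronese_ideal_def mpoly_eval_eq_subst)
    hence 1: "f' * ?sh (g s) \<in> ?G"
      using ideal_gen_gen[of f' _ "?sh (g s)"] sh[OF fs(2)] by (auto simp: mult.commute)
    have E1: "E (f' * ?sh (g s)) \<in> tensor_ideal I (Suc r)"
    proof -
      have "secant_map r b (g s) * slot r i \<in> tensor_ideal I (Suc r)"
        using ci sec_vars'[OF fs(2)]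
        by (intro tensor_ideal_mult[OF I] slot_in_tensor_ideal) auto
      thus ?thesis using f' fs \<open>subst b f' = i\<close> by (simp add: E_mult E_f E_g mult.commute)
    qed
    have eq: "(\<Sum>t\<in>insert s S. f t * ?sh (g t)) =
        f' * ?sh (g s) + (\<Sum>t\<in>S. f t * ?sh (g t + cst (c t) * g s))"
      using insert.hyps by (simp add: f'_def rename_def subst_add subst_mult algebra_simps sum.distrib
          sum_distrib_left)
    have "(\<Sum>t\<in>S. f t * ?sh (g t + cst (c t) * g s)) \<in> ?G"
    proof (rule insert.IH)
      show "E (\<Sum>t\<in>S. f t * ?sh (g t + cst (c t) * g s)) \<in> tensor_ideal I (Suc r)"
        using tensor_ideal_diff[OF insert.prems(3) E1] eq by (simp flip: E_diff)
    qed (use insert.prems in \<open>auto simp: poly_ring_eq intro!: in_vars_add in_vars_mult\<close>)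
    thus ?thesis unfolding eq by (intro ideal_gen_add 1)
  next
    case False
    \<comment> \<open>\<open>V\<close> is \<open>I\<close> plus the span of the other first factors.
      A functional that kills \<open>V\<close> and is 1 on \<open>subst b (f s)\<close>, used in row
      \<open>r\<close>, erases all summands except the one of \<open>s\<close>; this forces
      \<open>g s\<close> into \<open>J'\<close>.\<close>
    define V where "V = {p. \<exists>c. \<exists>i\<in>I. p = i + (\<Sum>t\<in>S. cst (c t) * subst b (f t))}"
    have I0: "0 \<in> I" "\<And>p q. p \<in> I \<Longrightarrow> q \<in> I \<Longrightarrow> p + q \<in> I" "\<And>a p. p \<in> I \<Longrightarrow> cst a * p \<in> I"
      using I by (auto simp: is_ideal_in_def poly_ring_eq)
    have IV: "i + (\<Sum>t\<in>S. cst (c t) * subst b (f t)) \<in> V" if "i \<in> I" for i c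
      using that by (auto simp: V_def)
    have "\<exists>\<mu>\<in>annihilator V. lext (\<lambda>x. x) \<mu> (subst b (f s)) = 1"
    proof (rule separating_functional)
      show "0 \<in> V" using IV[OF I0(1), of "\<lambda>_. 0"] by (simp add: cst.c_0)
      show "p + q \<in> V" if pq: "p \<in> V" "q \<in> V" for p q
      proof -
        obtain c i d j where "i \<in> I" "p = i + (\<Sum>t\<in>S. cst (c t) * subst b (f t))"
          "j \<in> I" "q = j + (\<Sum>t\<in>S. cst (d t) * subst b (f t))" using pq unfolding V_def by blast
        thus ?thesis using IV[OF I0(2), of i j "\<lambda>t. c t + d t"]
          by (simp add: cst.c_add distrib_right sum.distrib add_ac)
      qed
      show "cst a * p \<in> V" if p: "p \<in> V" for a p
      proof -
        obtain c i where "i \<in> I" "p = i + (\<Sum>t\<in>S. cst (c t) * subst b (f t))"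
          using p unfolding V_def by blast
        thus ?thesis using IV[OF I0(3), of i a "\<lambda>t. a * c t"]
          by (simp add: cst.c_mult distrib_left sum_distrib_left mult.assoc)
      qed
      show "subst b (f s) \<notin> V" using False by (simp add: V_def)
    qed
    then obtain \<mu> where \<mu>: "\<And>p. p \<in> V \<Longrightarrow> lext (\<lambda>x. x) \<mu> p = 0" "lext (\<lambda>x. x) \<mu> (subst b (f s)) = 1"
      by (auto simp: annihilator_def)
    have "\<mu> \<in> annihilator I"
      using IV[of _ "\<lambda>_. 0"] \<mu>(1) by (simp add: annihilator_def cst.c_0)
    have \<mu>f: "lext (\<lambda>x. x) \<mu> (subst b (f t)) = 0" if "t \<in> S" for t
    proof (rule \<mu>(1))
      have "(\<Sum>u\<in>S. cst (if u = t then 1 else 0) * subst b (f u)) = (\<Sum>u\<in>S. if u = t then subst b (f u) else 0)"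
        by (rule sum.cong) (auto simp: cst.c_1 cst.c_0)
      also have "\<dots> = subst b (f t)" using that insert.hyps by simp
      finally show "subst b (f t) \<in> V"
        using IV[OF I0(1), of "\<lambda>u. if u = t then 1 else 0"] by simp
    qed
    have "secant_map r b (g s) \<in> tensor_ideal I r"
      unfolding tensor_ideal_def
    proof (intro CollectI allI impI)
      fix \<Lambda> assume \<Lambda>: "\<forall>l<r. \<Lambda> l \<in> annihilator I"
      define \<Lambda>' where "\<Lambda>' = \<Lambda>(r := \<mu>)"
      have "0 = tensor_app (Suc r) \<Lambda>' (E (\<Sum>t\<in>insert s S. f t * ?sh (g t)))"
        by (rule tensor_idealD[OF insert.prems(3), symmetric])
           (use \<Lambda> \<open>\<mu> \<in> annihilator I\<close> in \<open>auto simp: \<Lambda>'_def less_Suc_eq\<close>)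
      also have "\<dots> = (\<Sum>t\<in>insert s S. tensor_app (Suc r) \<Lambda>' (slot r (subst b (f t)) * secant_map r b (g t)))"
        unfolding E_sum tensor_app_sum
        by (rule sum.cong) (use insert.prems in \<open>auto simp: E_mult E_f E_g\<close>)
      also have "\<dots> = (\<Sum>t\<in>insert s S. lext (\<lambda>x. x) \<mu> (subst b (f t)) * tensor_app r \<Lambda>' (secant_map r b (g t)))"
        by (rule sum.cong) (use insert.prems sec_vars in \<open>auto simp: tensor_app_slot_mult \<Lambda>'_def\<close>)
      also have "\<dots> = tensor_app r \<Lambda>' (secant_map r b (g s))"
        using insert.hyps \<mu>(2) \<mu>f by simp
      also have "\<dots> = tensor_app r \<Lambda> (secant_map r b (g s))"
        unfolding tensor_app_def by (rule lext_cong, rule prod.cong) (auto simp: \<Lambda>'_def)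
      finally show "tensor_app r \<Lambda> (secant_map r b (g s)) = 0" by simp
    qed
    hence gs: "g s \<in> J'" using fs by (simp add: J'_def)
    hence 1: "f s * ?sh (g s) \<in> ?G" using le[OF fs(1)] by (intro ideal_gen_gen) auto
    have E1: "E (f s * ?sh (g s)) \<in> tensor_ideal I (Suc r)"
    proof -
      have "secant_map r b (g s) \<in> tensor_ideal I (Suc r)"
        using gs fs by (intro tensor_ideal_Suc sec_vars) (auto simp: J'_def)
      moreover have "in_vars (UNIV \<times> {..<n}) (slot r (subst b (f s)))"
        using subst_b[OF fs(1)] by (intro in_vars_slot) (auto simp: poly_ring_eq)
      ultimately show ?thesis using tensor_ideal_mult[OF I] fs by (simp add: E_mult E_f E_g)
    qed
    have eq: "(\<Sum>t\<in>insert s S. f t * ?sh (g t)) = f s * ?sh (g s) + (\<Sum>t\<in>S. f t * ?sh (g t))"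
      using insert.hyps by simp
    have "(\<Sum>t\<in>S. f t * ?sh (g t)) \<in> ?G"
    proof (rule insert.IH)
      show "E (\<Sum>t\<in>S. f t * ?sh (g t)) \<in> tensor_ideal I (Suc r)"
        using tensor_ideal_diff[OF insert.prems(3) E1] eq by (simp flip: E_diff)
    qed (use insert.prems in auto)
    thus ?thesis unfolding eq by (intro ideal_gen_add 1)
  qed
qed

text \<open>In the step, \<open>E\<close> after \<open>\<Delta>\<close> is
  \<open>secant_map (Suc r) b\<close>. A polynomial in \<open>2 * N\<close> variables lies in the
  ideal generated by the two factors iff \<open>E\<close> maps it into
  \<open>tensor_ideal I (Suc r)\<close>: one direction holds since that set absorbs multiplication,
  the other is the elimination argument applied to a splitting into pure tensors.\<close>

lemma join_pow_eq_kernel: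
  assumes "r \<ge> 1"
  shows "join_pow N (veronese_ideal I N b) r = {q \<in> poly_ring N. secant_map r b q \<in> tensor_ideal I r}"
  using assms
proof (induction rule: dec_induct)
  case base
  have "secant_map 1 b q \<in> tensor_ideal I 1 \<longleftrightarrow> subst b q \<in> I" for q
  proof
    have eq: "secant_map 1 b q = slot 0 (subst b q)" by (simp add: secant_map_def slot_subst)
    show "secant_map 1 b q \<in> tensor_ideal I 1" if "subst b q \<in> I"
      unfolding eq using that by (rule slot_in_tensor_ideal) simp
    show "subst b q \<in> I" if q: "secant_map 1 b q \<in> tensor_ideal I 1"
    proof (rule ccontr)
      assume "subst b q \<notin> I"
      hence "\<exists>\<mu>\<in>annihilator I. lext (\<lambda>x. x) \<mu> (subst b q) = 1"
        using I by (intro separating_functional) (auto simp: is_ideal_in_def poly_ring_eq)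
      then obtain \<mu> where \<mu>: "\<mu> \<in> annihilator I" "lext (\<lambda>x. x) \<mu> (subst b q) = 1" by blast
      have "tensor_app 1 (\<lambda>_. \<mu>) (secant_map 1 b q) = 0" by (rule tensor_idealD[OF q]) (rule \<mu>(1))
      thus False using \<mu>(2) by (simp add: eq[simplified] tensor_app_slot)
    qed
  qed
  then show ?case by (simp add: veronese_ideal_def mpoly_eval_eq_subst)
next
  case (step r)
  \<comment> \<open>The first tensor factor goes to the new row \<open>r\<close>, the second one to
    the rows below, where \<open>secant_map r b\<close> takes its values.\<close>
  define E where "E = subst (\<lambda>v. if v < N then slot r (b v) else \<Sum>l<r. slot l (b (v - N)))"
  define J where "J = veronese_ideal I N b"
  define J' where "J' = {q \<in> poly_ring N. secant_map r b q \<in> tensor_ideal I r}"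
  let ?G = "ideal_gen (poly_ring (2 * N)) (J \<union> rename ((+) N) ` J')"
  let ?\<Delta> = "subst (\<lambda>j. var j + var (N + j)) :: 'k mpoly \<Rightarrow> 'k mpoly"
  have E_f: "E p = slot r (subst b p)" if "p \<in> poly_ring N" for p
    using that unfolding E_def slot_subst by (intro subst_cong[of "{..<N}"]) (auto simp: poly_ring_eq)
  have E_g: "E (rename ((+) N) p) = secant_map r b p" if "p \<in> poly_ring N" for p
    using that unfolding E_def secant_map_def rename_def by (simp add: subst_subst)
  have E_in: "E p \<in> tensor_ideal I (Suc r)" if pG: "p \<in> ?G" for p
  proof -
    obtain F c where p: "p = (\<Sum>s\<in>F. c s * s)" "F \<subseteq> J \<union> rename ((+) N) ` J'"
      "\<forall>s\<in>F. c s \<in> poly_ring (2 * N)" using pG by (auto simp: ideal_gen_def)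
    have "E (c s * s) \<in> tensor_ideal I (Suc r)" if s: "s \<in> F" for s
    proof -
      have "in_vars (UNIV \<times> {..<n}) (E (c s))"
        unfolding E_def
      proof (rule in_vars_subst)
        show "in_vars {..<2 * N} (c s)" using p(3) s by (auto simp: poly_ring_eq)
        show "in_vars (UNIV \<times> {..<n}) (if v < N then slot r (b v) else \<Sum>l<r. slot l (b (v - N)))"
          if "v \<in> {..<2 * N}" for v
          using that b[of v] b[of "v - N"] by (auto simp: poly_ring_eq intro!: in_vars_sum in_vars_slot)
      qed
      moreover have "E s \<in> tensor_ideal I (Suc r)"
      proof -
        consider "s \<in> J" | t where "t \<in> J'" "s = rename ((+) N) t" using p(2) s by blast
        thus ?thesis
        proof cases
          case 1
          thus ?thesis unfolding J_def veronese_ideal_def mpoly_eval_eq_subst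
            by (auto simp: E_f intro: slot_in_tensor_ideal)
        next
          case 2
          have "in_vars ({..<r} \<times> UNIV) (secant_map r b t)"
            using in_vars_secant_map[OF _ b] by (rule in_vars_mono) (use 2 in \<open>auto simp: J'_def\<close>)
          thus ?thesis using 2 by (auto simp: J'_def E_g intro!: tensor_ideal_Suc)
        qed
      qed
      ultimately show ?thesis using tensor_ideal_mult[OF I] by (simp add: E_def subst_mult)
    qed
    hence "(\<Sum>s\<in>F. E (c s * s)) \<in> tensor_ideal I (Suc r)" by (rule tensor_ideal_sum)
    thus ?thesis by (simp add: p(1) E_def subst_sum)
  qed
  have in_G: "p \<in> ?G" if p: "p \<in> poly_ring (2 * N)" and Ep: "E p \<in> tensor_ideal I (Suc r)" for p
  proof -
    have "\<forall>m\<in>Poly_Mapping.keys p. \<exists>f g. f \<in> poly_ring N \<and> g \<in> poly_ring N \<and>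
        Poly_Mapping.single m (Poly_Mapping.lookup p m) = f * rename ((+) N) g"
      using p poly_ring_split_monomial unfolding poly_ring_def by blast
    then obtain f g where fg: "\<And>m. m \<in> Poly_Mapping.keys p \<Longrightarrow> f m \<in> poly_ring N"
      "\<And>m. m \<in> Poly_Mapping.keys p \<Longrightarrow> g m \<in> poly_ring N"
      "\<And>m. m \<in> Poly_Mapping.keys p \<Longrightarrow>
        Poly_Mapping.single m (Poly_Mapping.lookup p m) = f m * rename ((+) N) (g m)"
      by metis
    have eq: "p = (\<Sum>m\<in>Poly_Mapping.keys p. f m * rename ((+) N) (g m))"
      by (subst poly_mapping_expand) (auto intro!: sum.cong fg(3))
    have "(\<Sum>m\<in>Poly_Mapping.keys p. f m * rename ((+) N) (g m)) \<in> ?G"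
      unfolding J_def J'_def
      by (rule join_kernel_finite_sum) (use fg Ep in \<open>auto simp: E_def simp flip: eq\<close>)
    thus ?thesis by (simp flip: eq)
  qed
  have E_\<Delta>: "E (?\<Delta> q) = secant_map (Suc r) b q" if "q \<in> poly_ring N" for q
    unfolding E_def secant_map_def subst_subst
    by (rule subst_cong[of "{..<N}"]) (use that in \<open>auto simp: poly_ring_eq subst_add\<close>)
  have \<Delta>_in: "?\<Delta> q \<in> poly_ring (2 * N)" if "q \<in> poly_ring N" for q
    using that unfolding poly_ring_eq by (auto intro!: in_vars_subst[of "{..<N}"] in_vars_add in_vars_var)
  have "join_pow N J (Suc r) = join_ideal N J (join_pow N J r)"
    using step.hyps by (cases r) auto
  also have "\<dots> = join_ideal N J J'" using step.IH by (simp add: J_def J'_def)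
  also have "\<dots> = {q \<in> poly_ring N. ?\<Delta> q \<in> ?G}"
    by (simp add: join_ideal_def mpoly_eval_eq_subst mvar_eq_var rename_def)
  also have "\<dots> = {q \<in> poly_ring N. secant_map (Suc r) b q \<in> tensor_ideal I (Suc r)}"
    using E_in in_G E_\<Delta> \<Delta>_in by auto metis
  finally show ?case by (simp add: J_def)
qed

end

section \<open>Noetherianity up to shifts of the rows\<close>

lemma mon_deg_superset:
  "finite S \<Longrightarrow> Poly_Mapping.keys m \<subseteq> S \<Longrightarrow> mon_deg m = (\<Sum>i\<in>S. Poly_Mapping.lookup m i)"
  unfolding mon_deg_def by (rule sum.mono_neutral_left) (auto simp: in_keys_iff)

lemma mon_deg_0 [simp]: "mon_deg 0 = 0"
  by (simp add: mon_deg_def)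

lemma mon_deg_add [simp]: "mon_deg (m + m') = mon_deg m + mon_deg m'"
proof -
  let ?S = "Poly_Mapping.keys m \<union> Poly_Mapping.keys m'"
  have "mon_deg (m + m') = (\<Sum>i\<in>?S. Poly_Mapping.lookup (m + m') i)"
    by (rule mon_deg_superset) (auto simp: keys_add)
  also have "\<dots> = mon_deg m + mon_deg m'"
    by (subst (1 2) mon_deg_superset[of ?S]) (auto simp: lookup_add sum.distrib)
  finally show ?thesis .
qed

lemma mon_deg_eq_0_iff [simp]: "mon_deg m = 0 \<longleftrightarrow> m = 0"
  by (auto simp: mon_deg_def in_keys_iff intro!: poly_mapping_eqI)

lemma lookup_le_mon_deg: "Poly_Mapping.lookup m j \<le> mon_deg m"
  by (cases "j \<in> Poly_Mapping.keys m")
     (auto simp: mon_deg_def in_keys_iff intro: member_le_sum)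

text \<open>All rows are prescribed, including absent ones: for nonzero \<open>F\<close> this makes
  \<open>\<delta>\<close> vanish outside finitely many rows, while 0 has every multidegree.\<close>

definition multihom :: "(nat \<Rightarrow> nat) \<Rightarrow> ((nat \<times> nat \<Rightarrow>\<^sub>0 nat) \<Rightarrow>\<^sub>0 'k::zero) \<Rightarrow> bool" where
  "multihom \<delta> F \<longleftrightarrow> (\<forall>m\<in>Poly_Mapping.keys F. \<forall>i. mon_deg (row i m) = \<delta> i)"

lemma multihom_0 [simp]: "multihom \<delta> 0"
  by (simp add: multihom_def)

lemma multihom_add: "multihom \<delta> F \<Longrightarrow> multihom \<delta> G \<Longrightarrow> multihom \<delta> (F + G)"
  using keys_add[of F G] by (auto simp: multihom_def)

lemma multihom_sum: "(\<And>x. x \<in> S \<Longrightarrow> multihom \<delta> (f x)) \<Longrightarrow> multihom \<delta> (\<Sum>x\<in>S. f x)"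
  by (induction S rule: infinite_finite_induct) (auto simp: multihom_add)

lemma multihom_diff:
  fixes F G :: "(nat \<times> nat \<Rightarrow>\<^sub>0 nat) \<Rightarrow>\<^sub>0 'k::comm_ring_1"
  assumes "multihom \<delta> F" "multihom \<delta> G" shows "multihom \<delta> (F - G)"
  unfolding multihom_def
proof
  fix m assume "m \<in> Poly_Mapping.keys (F - G)"
  hence "m \<in> Poly_Mapping.keys F \<or> m \<in> Poly_Mapping.keys G" by (auto simp: in_keys_iff lookup_minus)
  thus "\<forall>i. mon_deg (row i m) = \<delta> i" using assms by (auto simp: multihom_def)
qed

lemma multihom_mult:
  "multihom \<delta> F \<Longrightarrow> multihom \<epsilon> G \<Longrightarrow> multihom (\<lambda>i. \<delta> i + \<epsilon> i) (F * G)"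
  unfolding multihom_def using keys_mult[of F G] by (fastforce simp del: split_paired_All)

lemma multihom_single: "multihom (\<lambda>i. mon_deg (row i m)) (Poly_Mapping.single m a)"
  by (simp add: multihom_def)

lemma lookup_single_mult:
  "Poly_Mapping.lookup (Poly_Mapping.single u a * p) (u + w) = a * Poly_Mapping.lookup p w"
  for u w :: "'v \<Rightarrow>\<^sub>0 nat"
  by (induction p rule: poly_mapping_single_induct)
     (auto simp: mult_single lookup_single when_def lookup_add distrib_left)

lemma keys_single_mult:
  "Poly_Mapping.keys (Poly_Mapping.single u a * p) \<subseteq> (+) u ` Poly_Mapping.keys p"
  using keys_mult[of "Poly_Mapping.single u a" p] by (auto split: if_splits)

text \<open>Although \<open>\<delta>\<close> is an arbitrary function, a single monomial of that
  multidegree confines its support to the finitely many rows \<open>R\<close>; the exponents are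
  then bounded by the sum \<open>D\<close>.\<close>

lemma finite_monomials_of_multidegree:
  "finite {m. Poly_Mapping.keys m \<subseteq> UNIV \<times> {..<n} \<and> (\<forall>i. mon_deg (row i m) = \<delta> i)}" (is "finite ?M")
proof (cases "?M = {}")
  case False
  then obtain m0 where m0: "\<And>i. mon_deg (row i m0) = \<delta> i" by auto
  define R where "R = fst ` Poly_Mapping.keys m0"
  have R: "\<delta> i = 0" if "i \<notin> R" for i
  proof -
    have "row i m0 = 0" by (rule row_eq_0[of _ R UNIV]) (use that in \<open>force simp: R_def\<close>)+
    thus ?thesis using m0[of i] by simp
  qed
  have finR: "finite R" by (simp add: R_def)
  define D where "D = (\<Sum>i\<in>R. \<delta> i)"
  let ?FF = "{f. \<forall>x. (x \<in> R \<times> {..<n} \<longrightarrow> f x \<in> {..D}) \<and> (x \<notin> R \<times> {..<n} \<longrightarrow> f x = 0)}"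
  have "Poly_Mapping.lookup ` ?M \<subseteq> ?FF"
  proof clarify
    fix m i j assume m: "Poly_Mapping.keys m \<subseteq> UNIV \<times> {..<n}" "\<forall>i. mon_deg (row i m) = \<delta> i"
    have le: "Poly_Mapping.lookup m (i, j) \<le> \<delta> i" using lookup_le_mon_deg[of "row i m" j] m by simp
    have "Poly_Mapping.lookup m (i, j) \<le> D" if "i \<in> R"
      using le member_le_sum[OF that, of \<delta>] finR by (simp add: D_def)
    moreover have "Poly_Mapping.lookup m (i, j) = 0" if "i \<notin> R" using le R[OF that] by simp
    moreover have "Poly_Mapping.lookup m (i, j) = 0" if "\<not> j < n"
      using m(1) that by (auto simp flip: not_in_keys_iff_lookup_eq_zero)
    ultimately show "((i, j) \<in> R \<times> {..<n} \<longrightarrow> Poly_Mapping.lookup m (i, j) \<in> {..D}) \<and>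
        ((i, j) \<notin> R \<times> {..<n} \<longrightarrow> Poly_Mapping.lookup m (i, j) = 0)" by auto
  qed
  moreover have "finite ?FF" using finR by (intro finite_set_of_finite_funs) auto
  ultimately have "finite (Poly_Mapping.lookup ` ?M)" by (rule finite_subset)
  thus ?thesis by (rule finite_imageD) (rule inj_onI, simp only: poly_mapping_eq_iff)
qed (simp only: finite.emptyI)

definition shift_dvd :: "(nat \<times> nat \<Rightarrow>\<^sub>0 nat) \<Rightarrow> (nat \<times> nat \<Rightarrow>\<^sub>0 nat) \<Rightarrow> bool" where
  "shift_dvd m m' \<longleftrightarrow> (\<exists>\<iota> u. strict_mono \<iota> \<and> m' = u + mon_rename (apfst \<iota>) m)"

lemma inj_apfst: "inj \<iota> \<Longrightarrow> inj (apfst \<iota> :: 'a \<times> 'c \<Rightarrow> 'b \<times> 'c)"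
  by (auto simp: inj_def)

text \<open>A monomial is read as the word of its row exponent vectors. Letters are compared by
  Dickson's order on the first \<open>n\<close> coordinates, and an embedding of words is a shift
  followed by multiplication with a monomial.\<close>

lemma shift_dvd_good:
  fixes f :: "nat \<Rightarrow> (nat \<times> nat \<Rightarrow>\<^sub>0 nat)"
  assumes "\<And>i. Poly_Mapping.keys (f i) \<subseteq> UNIV \<times> {..<n}"
  shows "\<exists>i j. i < j \<and> shift_dvd (f i) (f j)"
proof -
  let ?P = "\<lambda>v w :: nat \<Rightarrow> nat. \<forall>j<n. v j \<le> w j"
  \<comment> \<open>One more than the last occupied row; the inserted 0 keeps \<open>Max\<close>
    meaningful for the monomial 1.\<close>
  define e where "e m = Suc (Max (insert 0 (fst ` Poly_Mapping.keys m)))" for m :: "nat \<times> nat \<Rightarrow>\<^sub>0 nat"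
  have e: "Poly_Mapping.lookup m (i, j) = 0" if ie: "\<not> i < e m" for m i j
  proof (rule ccontr)
    assume "Poly_Mapping.lookup m (i, j) \<noteq> 0"
    hence "(i, j) \<in> Poly_Mapping.keys m" by (simp add: in_keys_iff)
    hence "i \<le> Max (insert 0 (fst ` Poly_Mapping.keys m))" by (intro Max_ge) force+
    thus False using ie by (simp add: e_def)
  qed
  define word where "word m = map (\<lambda>i j. Poly_Mapping.lookup m (i, j)) [0..<e m]" for m :: "nat \<times> nat \<Rightarrow>\<^sub>0 nat"
  obtain i j where ij: "i < j" "list_emb ?P (word (f i)) (word (f j))"
    using wqo_list_emb[OF wqo_pointwise_le[of n], where f = "\<lambda>i. word (f i)"] by blast
  obtain \<iota> where \<iota>: "strict_mono \<iota>" "\<And>k. k < length (word (f i)) \<Longrightarrow>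
      \<iota> k < length (word (f j)) \<and> ?P (word (f i) ! k) (word (f j) ! \<iota> k)"
    using list_emb_strict_mono[OF ij(2)] by blast
  let ?m = "mon_rename (apfst \<iota>) (f i)"
  have inj: "inj (apfst \<iota> :: nat \<times> nat \<Rightarrow> nat \<times> nat)"
    using \<iota>(1) by (intro inj_apfst strict_mono_imp_inj_on)
  have le: "Poly_Mapping.lookup ?m v \<le> Poly_Mapping.lookup (f j) v" for v
  proof (cases "v \<in> range (apfst \<iota>)")
    case True
    then obtain k l where v: "v = apfst \<iota> (k, l)" by (metis imageE surj_pair)
    have *: "Poly_Mapping.lookup ?m v = Poly_Mapping.lookup (f i) (k, l)"
      unfolding v by (rule lookup_mon_rename_inj[OF inj])
    show ?thesis
    proof (cases "k < e (f i) \<and> l < n")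
      case True
      thus ?thesis using \<iota>(2)[of k] * by (auto simp: word_def v)
    next
      case False
      hence "Poly_Mapping.lookup (f i) (k, l) = 0"
        using e assms[of i] by (auto simp flip: not_in_keys_iff_lookup_eq_zero)
      thus ?thesis using * by simp
    qed
  qed (simp add: lookup_mon_rename_notin)
  have "f j = (f j - ?m) + ?m"
    by (rule poly_mapping_eqI) (simp add: lookup_add minus_poly_mapping.rep_eq le)
  hence "shift_dvd (f i) (f j)" using \<iota>(1) unfolding shift_dvd_def by blast
  thus ?thesis using ij(1) by blast
qed

text \<open>Monomials are compared at the least variable where they differ, variables being ordered
  lexicographically. A strictly increasing map of the rows preserves the order of the variables,
  hence carries this place to the corresponding one; outside the range both exponents are 0.\<close>

lemma mon_rename_apfst_less:
  fixes a b :: "nat \<times> nat \<Rightarrow>\<^sub>0 nat"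
  assumes \<iota>: "strict_mono \<iota>" and "a < b"
  shows "mon_rename (apfst \<iota>) a < mon_rename (apfst \<iota> :: nat \<times> nat \<Rightarrow> nat \<times> nat) b"
proof -
  have inj: "inj (apfst \<iota> :: nat \<times> nat \<Rightarrow> nat \<times> nat)"
    using \<iota> by (intro inj_apfst strict_mono_imp_inj_on)
  obtain v where v: "Poly_Mapping.lookup a v < Poly_Mapping.lookup b v"
    "\<And>w. w < v \<Longrightarrow> Poly_Mapping.lookup a w = Poly_Mapping.lookup b w"
    using assms(2) unfolding less_poly_mapping.rep_eq less_fun_def by metis
  have "Poly_Mapping.lookup (mon_rename (apfst \<iota>) a) w = Poly_Mapping.lookup (mon_rename (apfst \<iota>) b) w"
    if w: "w < apfst \<iota> v" for w
  proof (cases "w \<in> range (apfst \<iota> :: nat \<times> nat \<Rightarrow> nat \<times> nat)")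
    case True
    then obtain w' where w': "w = apfst \<iota> w'" by blast
    have "w' < v" using w \<iota> unfolding w'
      by (cases v; cases w') (auto simp: less_prod_simp strict_mono_less strict_mono_less_eq)
    thus ?thesis using v(2) by (simp add: w' lookup_mon_rename_inj[OF inj])
  qed (simp add: lookup_mon_rename_notin)
  thus ?thesis using v(1) unfolding less_poly_mapping.rep_eq less_fun_def
    by (intro exI[of _ "apfst \<iota> v"]) (simp add: lookup_mon_rename_inj[OF inj])
qed

text \<open>Every summand, and not only the sum, has to be of multidegree \<open>\<delta>\<close>,
  so that the sum can be depolarized term by term over one set of rows.\<close>

inductive_set shift_span :: "nat \<Rightarrow> ((nat \<times> nat \<Rightarrow>\<^sub>0 nat) \<Rightarrow>\<^sub>0 'k::comm_ring_1) set \<Rightarrow> (nat \<Rightarrow> nat) \<Rightarrow> ((nat \<times> nat \<Rightarrow>\<^sub>0 nat) \<Rightarrow>\<^sub>0 'k) set"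
  for n G \<delta> where
  zero: "0 \<in> shift_span n G \<delta>"
| step: "F \<in> shift_span n G \<delta> \<Longrightarrow> g \<in> G \<Longrightarrow> strict_mono \<iota> \<Longrightarrow> Poly_Mapping.keys u \<subseteq> UNIV \<times> {..<n} \<Longrightarrow>
    multihom \<delta> (Poly_Mapping.single u a * rename (apfst \<iota>) g) \<Longrightarrow>
    F + Poly_Mapping.single u a * rename (apfst \<iota>) g \<in> shift_span n G \<delta>"

text \<open>Multihomogeneity makes the division algorithm terminate: there are only finitely many monomials
  of a given multidegree, although the lexicographic order is not well-founded.\<close>

lemma shift_noetherian:
  fixes K :: "((nat \<times> nat \<Rightarrow>\<^sub>0 nat) \<Rightarrow>\<^sub>0 'k::field) set"
  assumes vars: "\<And>F. F \<in> K \<Longrightarrow> in_vars (UNIV \<times> {..<n}) F"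
    and hom: "\<And>F. F \<in> K \<Longrightarrow> \<exists>\<delta>. multihom \<delta> F"
    and diff: "\<And>F G \<delta>. F \<in> K \<Longrightarrow> G \<in> K \<Longrightarrow> multihom \<delta> F \<Longrightarrow> multihom \<delta> G \<Longrightarrow> F - G \<in> K"
    and mult: "\<And>F u a. F \<in> K \<Longrightarrow> Poly_Mapping.keys u \<subseteq> UNIV \<times> {..<n} \<Longrightarrow> Poly_Mapping.single u a * F \<in> K"
    and shift: "\<And>F \<iota>. F \<in> K \<Longrightarrow> strict_mono \<iota> \<Longrightarrow> rename (apfst \<iota>) F \<in> K"
  shows "\<exists>G\<subseteq>K. finite G \<and> (\<forall>F\<in>K. \<forall>\<delta>. multihom \<delta> F \<longrightarrow> F \<in> shift_span n G \<delta>)"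
proof -
  define lm where "lm F = Max (Poly_Mapping.keys F)" for F :: "(nat \<times> nat \<Rightarrow>\<^sub>0 nat) \<Rightarrow>\<^sub>0 'k"
  have lm_in: "lm F \<in> Poly_Mapping.keys F" if "F \<noteq> 0" for F :: "(nat \<times> nat \<Rightarrow>\<^sub>0 nat) \<Rightarrow>\<^sub>0 'k"
    unfolding lm_def using that by (intro Max_in) (auto simp: poly_mapping_eq_iff fun_eq_iff in_keys_iff)
  have lm_ge: "m \<le> lm F" if "m \<in> Poly_Mapping.keys F" for m and F :: "(nat \<times> nat \<Rightarrow>\<^sub>0 nat) \<Rightarrow>\<^sub>0 'k"
    unfolding lm_def using that by simp
  have "\<exists>B\<subseteq>lm ` (K - {0}). finite B \<and> (\<forall>m\<in>lm ` (K - {0}). \<exists>b\<in>B. shift_dvd b m)"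
  proof (rule good_imp_finite_basis, rule shift_dvd_good)
    fix f :: "nat \<Rightarrow> (nat \<times> nat \<Rightarrow>\<^sub>0 nat)" and i
    assume "\<And>i. f i \<in> lm ` (K - {0})"
    then obtain F where "F \<in> K" "F \<noteq> 0" "f i = lm F" by blast
    thus "Poly_Mapping.keys (f i) \<subseteq> UNIV \<times> {..<n}" using vars lm_in by (auto simp: in_vars_def)
  qed
  then obtain B where B: "B \<subseteq> lm ` (K - {0})" "finite B"
    "\<And>m. m \<in> lm ` (K - {0}) \<Longrightarrow> \<exists>b\<in>B. shift_dvd b m" by blast
  obtain G where G: "G \<subseteq> K - {0}" "finite G" "B = lm ` G"
    using B(1,2) by (meson finite_subset_image)
  define M where "M \<delta> = {m. Poly_Mapping.keys m \<subseteq> UNIV \<times> {..<n} \<and> (\<forall>i. mon_deg (row i m) = \<delta> i)}" for \<delta> :: "nat \<Rightarrow> nat"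
  have "F \<in> shift_span n G \<delta>" if "F \<in> K" "multihom \<delta> F" for F \<delta>
    using that
  proof (induction "card {m \<in> M \<delta>. m < lm F}"
      arbitrary: F rule: less_induct)
    case less
    show ?case
    proof (cases "F = 0")
      case False
      hence "lm F \<in> lm ` (K - {0})" using less.prems by blast
      then obtain g where g: "g \<in> G" "shift_dvd (lm g) (lm F)" using B(3) G(3) by blast
      then obtain \<iota> u where \<iota>: "strict_mono \<iota>" and u: "lm F = u + mon_rename (apfst \<iota>) (lm g)"
        by (auto simp: shift_dvd_def)
      have gK: "g \<in> K" "g \<noteq> 0" using g G by auto
      have inj: "inj (apfst \<iota> :: nat \<times> nat \<Rightarrow> nat \<times> nat)"
        using \<iota> by (intro inj_apfst strict_mono_imp_inj_on)
      define a where "a = Poly_Mapping.lookup F (lm F) / Poly_Mapping.lookup g (lm g)"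
      define t where "t = Poly_Mapping.single u a * rename (apfst \<iota>) g"
      have u_keys: "Poly_Mapping.keys u \<subseteq> UNIV \<times> {..<n}"
      proof -
        have "Poly_Mapping.keys u \<subseteq> Poly_Mapping.keys (lm F)" unfolding u by (auto simp: keys_add_nat)
        thus ?thesis using vars[OF less.prems(1)] lm_in[OF False] by (auto simp: in_vars_def)
      qed
      have tK: "t \<in> K" unfolding t_def by (intro mult shift gK \<iota> u_keys)
      have t_lm: "Poly_Mapping.lookup t (lm F) = Poly_Mapping.lookup F (lm F)"
        using lm_in[OF gK(2)]
        by (simp add: t_def u lookup_single_mult lookup_rename_inj[OF inj] in_keys_iff)
           (simp add: a_def u)
      have t_le: "m \<le> lm F" if mt: "m \<in> Poly_Mapping.keys t" for m
      proof -
        obtain w where w: "m = u + w" "w \<in> Poly_Mapping.keys (rename (apfst \<iota>) g)"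
          using mt keys_single_mult[of u a "rename (apfst \<iota>) g"] unfolding t_def by blast
        obtain w' where w': "w = mon_rename (apfst \<iota>) w'" "w' \<in> Poly_Mapping.keys g"
          using w(2) keys_rename[of "apfst \<iota>" g] by blast
        have "w' \<le> lm g" using lm_ge w' by simp
        hence "w \<le> mon_rename (apfst \<iota>) (lm g)"
          using mon_rename_apfst_less[OF \<iota>, of w' "lm g"] by (auto simp: w'(1) le_less)
        thus ?thesis by (simp add: w(1) u)
      qed
      \<comment> \<open>Closure under differences is available only within a common multidegree;
        \<open>t\<close> and \<open>F\<close> have the same one because they share the monomial
        \<open>lm F\<close>.\<close>
      obtain \<delta>' where \<delta>': "multihom \<delta>' t" using hom[OF tK] by blast
      have "\<delta>' = \<delta>"
      proof
        fix i
        have "lm F \<in> Poly_Mapping.keys t" using lm_in[OF False] t_lm by (simp add: in_keys_iff)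
        thus "\<delta>' i = \<delta> i" using \<delta>' less.prems(2) lm_in[OF False] by (metis multihom_def)
      qed
      hence t_hom: "multihom \<delta> t" using \<delta>' by simp
      define F' where "F' = F - t"
      have F': "F' \<in> K" "multihom \<delta> F'"
        unfolding F'_def using less.prems tK t_hom by (auto intro: diff multihom_diff)
      have "F' \<in> shift_span n G \<delta>"
      proof (cases "F' = 0")
        case F'0: False
        have "lm F' \<in> Poly_Mapping.keys F \<union> Poly_Mapping.keys t" "lm F' \<noteq> lm F"
          using lm_in[OF F'0] t_lm by (auto simp: F'_def in_keys_iff lookup_minus)
        hence lt: "lm F' < lm F" using lm_ge[of "lm F'" F] t_le by force
        have "lm F' \<in> M \<delta>"
          using vars[OF F'(1)] F'(2) lm_in[OF F'0] by (auto simp: in_vars_def multihom_def M_def)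
        hence "lm F' \<in> {m \<in> M \<delta>. m < lm F} - {m \<in> M \<delta>. m < lm F'}" using lt by simp
        moreover have "{m \<in> M \<delta>. m < lm F'} \<subseteq> {m \<in> M \<delta>. m < lm F}"
          using less_trans[OF _ lt] by blast
        moreover have "finite {m \<in> M \<delta>. m < lm F}"
          using finite_monomials_of_multidegree[of n \<delta>] unfolding M_def
          by (rule rev_finite_subset) blast
        ultimately have "card {m \<in> M \<delta>. m < lm F'} < card {m \<in> M \<delta>. m < lm F}"
          by (intro psubset_card_mono) blast+
        thus ?thesis using less.hyps F' by blast
      qed (simp add: shift_span.zero)
      hence "F' + t \<in> shift_span n G \<delta>"
        unfolding t_def using g(1) \<iota> u_keys t_hom[unfolded t_def] by (rule shift_span.step)
      thus ?thesis by (simp add: F'_def)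
    qed (simp add: shift_span.zero)
  qed
  thus ?thesis using G by blast
qed

section \<open>The shift-stable family of multihomogeneous relations\<close>

lemma apfst_comp: "apfst f \<circ> apfst g = apfst (f \<circ> g)"
  by (simp add: fun_eq_iff)

lemma rename_apfst_comp: "rename (apfst f) (rename (apfst g) F) = rename (apfst (f \<circ> g)) F"
  by (simp add: rename_rename apfst_comp)

lemma rename_apfst_slot: "rename (apfst f) (slot i p) = slot (f i) p"
  by (simp add: slot_def rename_rename comp_def)

lemma rename_apfst_cong:
  "in_vars (A \<times> UNIV) F \<Longrightarrow> (\<And>i. i \<in> A \<Longrightarrow> f i = g i) \<Longrightarrow> rename (apfst f) F = rename (apfst g) F"
  unfolding rename_def by (rule subst_cong) auto

lemma row_sum: "row l (\<Sum>i\<in>A. f i) = (\<Sum>i\<in>A. row l (f i))"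
  by (induction A rule: infinite_finite_induct) auto

lemma monomial_rows:
  assumes "finite W" "Poly_Mapping.keys m \<subseteq> W \<times> UNIV"
  shows "m = (\<Sum>i\<in>W. mon_rename (Pair i) (row i m))"
proof (rule row_eqI)
  fix l
  have "row l (\<Sum>i\<in>W. mon_rename (Pair i) (row i m)) = (\<Sum>i\<in>W. if l = i then row i m else 0)"
    by (auto simp: row_sum row_mon_rename_Pair intro!: sum.cong)
  thus "row l m = row l (\<Sum>i\<in>W. mon_rename (Pair i) (row i m))"
    using assms row_eq_0[of m W UNIV l] by (simp add: sum.delta')
qed

lemma single_eq_prod_slot:
  assumes "finite W" "Poly_Mapping.keys m \<subseteq> W \<times> UNIV"
  shows "Poly_Mapping.single m 1 = (\<Prod>i\<in>W. slot i (Poly_Mapping.single (row i m) 1))"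
  by (subst monomial_rows[OF assms]) (simp add: slot_def rename_single single_sum_exponent)

lemma mon_deg_row_mon_rename:
  fixes m :: "nat \<times> nat \<Rightarrow>\<^sub>0 nat"
  assumes "finite W" "Poly_Mapping.keys m \<subseteq> W \<times> UNIV"
  shows "mon_deg (row l (mon_rename (apfst f) m)) = (\<Sum>i\<in>{i\<in>W. f i = l}. mon_deg (row i m))"
proof -
  \<comment> \<open>The equality of exponents is obtained from an equality of one-term polynomials,
    by comparing their only key.\<close>
  have "Poly_Mapping.single (mon_rename (apfst f) m) (1::int) =
      Poly_Mapping.single (\<Sum>i\<in>W. mon_rename (Pair (f i)) (row i m)) 1"
    using arg_cong[OF single_eq_prod_slot[OF assms, where 'c = int], of "rename (apfst f)"]
    by (simp add: rename_single rename_prod rename_apfst_slot)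
       (simp add: slot_def rename_single single_sum_exponent)
  hence "Poly_Mapping.keys (Poly_Mapping.single (mon_rename (apfst f) m) (1::int)) =
    Poly_Mapping.keys (Poly_Mapping.single (\<Sum>i\<in>W. mon_rename (Pair (f i)) (row i m)) (1::int))" by simp
  hence eq: "mon_rename (apfst f) m = (\<Sum>i\<in>W. mon_rename (Pair (f i)) (row i m))" by simp
  have sum: "mon_deg (\<Sum>i\<in>A. g i) = (\<Sum>i\<in>A. mon_deg (g i))" for A and g :: "nat \<Rightarrow> nat \<Rightarrow>\<^sub>0 nat"
    by (induction A rule: infinite_finite_induct) auto
  have "mon_deg (row l (mon_rename (apfst f) m)) = (\<Sum>i\<in>W. if f i = l then mon_deg (row i m) else 0)"
    unfolding eq row_sum sum by (rule sum.cong) (auto simp: row_mon_rename_Pair)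
  thus ?thesis using assms(1) by (simp add: sum.If_cases Int_def)
qed

lemma in_vars_of_multihom:
  assumes "in_vars (UNIV \<times> A) F" "multihom \<delta> F" "\<And>i. i \<notin> W \<Longrightarrow> \<delta> i = 0"
  shows "in_vars (W \<times> A) F"
  unfolding in_vars_def
proof (intro ballI subrelI)
  fix m i j assume m: "m \<in> Poly_Mapping.keys F" and ij: "(i, j) \<in> Poly_Mapping.keys m"
  have "row i m \<noteq> 0" using ij by (auto simp: poly_mapping_eq_iff fun_eq_iff in_keys_iff)
  hence "\<delta> i \<noteq> 0" using assms(2) m by (metis multihom_def mon_deg_eq_0_iff)
  hence "i \<in> W" using assms(3)[of i] by auto
  thus "(i, j) \<in> W \<times> A" using assms(1) m ij by (auto simp: in_vars_def)
qed

lemma multihom_rename: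
  assumes "finite W" "in_vars (W \<times> UNIV) F" "multihom \<delta> F"
  shows "multihom (\<lambda>l. \<Sum>i\<in>{i\<in>W. f i = l}. \<delta> i) (rename (apfst f) F)"
  unfolding multihom_def
proof (intro ballI allI)
  fix m l assume "m \<in> Poly_Mapping.keys (rename (apfst f) F)"
  then obtain m' where "m' \<in> Poly_Mapping.keys F" "m = mon_rename (apfst f) m'"
    using keys_rename[of "apfst f" F] by blast
  thus "mon_deg (row l m) = (\<Sum>i\<in>{i\<in>W. f i = l}. \<delta> i)"
    using assms by (auto simp: mon_deg_row_mon_rename in_vars_def multihom_def intro!: sum.cong)
qed

lemma ex_finite_rows:
  fixes F :: "(nat \<times> nat \<Rightarrow>\<^sub>0 nat) \<Rightarrow>\<^sub>0 'k::comm_ring_1"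
  shows "\<exists>W. finite W \<and> in_vars (W \<times> UNIV) F"
proof -
  have "in_vars ((\<Union>m\<in>Poly_Mapping.keys F. fst ` Poly_Mapping.keys m) \<times> UNIV) F"
    by (force simp: in_vars_def)
  thus ?thesis by (intro exI conjI) auto
qed

text \<open>The family \<open>K\<close> of the overview. The maps \<open>\<phi>\<close> are total,
  so composing them with a renaming of the rows again gives an admissible map.\<close>

definition row_relations :: "nat \<Rightarrow> 'k::comm_ring_1 mpoly set \<Rightarrow> nat \<Rightarrow> ((nat \<times> nat \<Rightarrow>\<^sub>0 nat) \<Rightarrow>\<^sub>0 'k) set" where
  "row_relations n I r = {F. in_vars (UNIV \<times> {..<n}) F \<and> (\<exists>\<delta>. multihom \<delta> F) \<and>
      (\<forall>\<phi>. range \<phi> \<subseteq> {..<r} \<longrightarrow> rename (apfst \<phi>) F \<in> tensor_ideal I r)}"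

lemma row_relations_mult:
  assumes I: "is_ideal_in (poly_ring n) I"
    and F: "F \<in> row_relations n I r" and u: "Poly_Mapping.keys u \<subseteq> UNIV \<times> {..<n}"
  shows "Poly_Mapping.single u a * F \<in> row_relations n I r"
proof -
  have "in_vars (UNIV \<times> {..<n}) (rename (apfst \<phi>) (Poly_Mapping.single u a))" for \<phi> :: "nat \<Rightarrow> nat"
    using u by (intro in_vars_rename[of "UNIV \<times> {..<n}"] in_vars_single) auto
  moreover have "\<exists>\<delta>. multihom \<delta> (Poly_Mapping.single u a * F)"
    using F multihom_mult[OF multihom_single[of u a]] unfolding row_relations_def by blast
  ultimately show ?thesis using F u tensor_ideal_mult[OF I]
    by (auto simp: row_relations_def rename_mult intro!: in_vars_mult in_vars_single)
qed

text \<open>\<open>\<phi> \<circ> \<iota>\<close> is again a map into \<open>{..<r}\<close>.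
  Monotonicity of renamings matters only for the order on monomials.\<close>

lemma row_relations_shift:
  assumes "F \<in> row_relations n I r"
  shows "rename (apfst \<iota>) F \<in> row_relations n I r"
proof -
  obtain \<delta> where "multihom \<delta> F" using assms by (auto simp: row_relations_def)
  obtain W where "finite W" "in_vars (W \<times> UNIV) F" using ex_finite_rows by blast
  hence "\<exists>\<delta>. multihom \<delta> (rename (apfst \<iota>) F)" using multihom_rename \<open>multihom \<delta> F\<close> by blast
  moreover have "in_vars (UNIV \<times> {..<n}) (rename (apfst \<iota>) F)"
    using assms by (intro in_vars_rename[of "UNIV \<times> {..<n}"]) (auto simp: row_relations_def)
  moreover have "rename (apfst \<phi>) (rename (apfst \<iota>) F) \<in> tensor_ideal I r" if "range \<phi> \<subseteq> {..<r}" for \<phi>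
  proof -
    have "range (\<phi> \<circ> \<iota>) \<subseteq> {..<r}" using that by auto
    thus ?thesis using assms unfolding row_relations_def rename_apfst_comp by blast
  qed
  ultimately show ?thesis by (simp add: row_relations_def)
qed

lemma row_relations_noetherian:
  fixes I :: "'k::field mpoly set"
  assumes I: "is_ideal_in (poly_ring n) I"
  shows "\<exists>G\<subseteq>row_relations n I r. finite G \<and>
    (\<forall>F\<in>row_relations n I r. \<forall>\<delta>. multihom \<delta> F \<longrightarrow> F \<in> shift_span n G \<delta>)"
proof (rule shift_noetherian)
  show "F - G \<in> row_relations n I r"
    if "F \<in> row_relations n I r" "G \<in> row_relations n I r" "multihom \<delta> F" "multihom \<delta> G" for F G \<delta>
    using that multihom_diff[of \<delta> F G]
    by (auto simp: row_relations_def rename_diff intro!: in_vars_diff tensor_ideal_diff)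
  show "Poly_Mapping.single u a * F \<in> row_relations n I r"
    if "F \<in> row_relations n I r" "Poly_Mapping.keys u \<subseteq> UNIV \<times> {..<n}" for F u a
    using row_relations_mult[OF I] that by blast
  show "rename (apfst \<iota>) F \<in> row_relations n I r" if "F \<in> row_relations n I r" for F \<iota>
    using row_relations_shift that by blast
qed (simp_all add: row_relations_def)

section \<open>Polarization\<close>

text \<open>Telescoping: one factor is replaced at a time, and the bound on the variables lets the
  ideal absorb the cofactors.\<close>

lemma tensor_ideal_prod_cong:
  assumes I: "is_ideal_in (poly_ring n) I"
    and "finite W" "\<And>i. i \<in> W \<Longrightarrow> x i - y i \<in> tensor_ideal I r"
    "\<And>i. i \<in> W \<Longrightarrow> in_vars (UNIV \<times> {..<n}) (x i)" "\<And>i. i \<in> W \<Longrightarrow> in_vars (UNIV \<times> {..<n}) (y i)"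
  shows "(\<Prod>i\<in>W. x i) - (\<Prod>i\<in>W. y i) \<in> tensor_ideal I r"
  using assms(2-)
proof (induction rule: finite_induct)
  case (insert w W)
  have "(\<Prod>i\<in>insert w W. x i) - (\<Prod>i\<in>insert w W. y i) =
      x w * ((\<Prod>i\<in>W. x i) - (\<Prod>i\<in>W. y i)) + (\<Prod>i\<in>W. y i) * (x w - y w)"
    using insert.hyps by (simp add: algebra_simps)
  thus ?case using insert
    by (auto intro!: tensor_ideal_add tensor_ideal_mult[OF I] in_vars_prod)
qed simp

text \<open>Depolarization, used with \<open>L\<close> sending a monomial of degree \<open>d\<close>
  to the linear form of its class in B_d. The product runs over \<open>W\<close>, so a row of
  \<open>W\<close> absent from a monomial contributes \<open>L 0\<close>.\<close>

definition row_prod :: "((nat \<Rightarrow>\<^sub>0 nat) \<Rightarrow> 'k mpoly) \<Rightarrow> nat set \<Rightarrow> ((nat \<times> nat \<Rightarrow>\<^sub>0 nat) \<Rightarrow>\<^sub>0 'k) \<Rightarrow> 'k::comm_ring_1 mpoly" where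
  "row_prod L W F = lext cst (\<lambda>m. \<Prod>i\<in>W. L (row i m)) F"

lemma row_prod_0 [simp]: "row_prod L W 0 = 0"
  and row_prod_add: "row_prod L W (F + G) = row_prod L W F + row_prod L W G"
  and row_prod_sum: "row_prod L W (\<Sum>x\<in>S. f x) = (\<Sum>x\<in>S. row_prod L W (f x))"
  and row_prod_cst_mult: "row_prod L W (cst a * F) = cst a * row_prod L W F"
  by (simp_all add: row_prod_def cst.lext_0 cst.lext_single cst.lext_add cst.lext_sum cst.lext_cst_mult)

lemma row_prod_mult:
  assumes W: "finite W" "finite W'" "W \<inter> W' = {}"
    and F: "in_vars (W \<times> UNIV) F" and G: "in_vars (W' \<times> UNIV) G"
  shows "row_prod L (W \<union> W') (F * G) = row_prod L W F * row_prod L W' G"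
  unfolding row_prod_def
proof (rule cst.lext_mult)
  fix m m' assume m: "m \<in> Poly_Mapping.keys F" and m': "m' \<in> Poly_Mapping.keys G"
  have "row i (m + m') = row i m" if "i \<in> W" for i
    using row_eq_0[of m' W' UNIV i] m' G W that by (auto simp: in_vars_def)
  moreover have "row i (m + m') = row i m'" if "i \<in> W'" for i
    using row_eq_0[of m W UNIV i] m F W that by (auto simp: in_vars_def)
  ultimately show "(\<Prod>i\<in>W \<union> W'. L (row i (m + m'))) = (\<Prod>i\<in>W. L (row i m)) * (\<Prod>i\<in>W'. L (row i m'))"
    using W by (subst prod.union_disjoint) (auto intro!: arg_cong2[where f = "(*)"] prod.cong simp del: row_add)
qed

lemma in_vars_UNIV: "in_vars UNIV p"
  by (simp add: in_vars_def)

lemma row_prod_slot: "row_prod L {i} (slot i p) = lext cst L p"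
  by (simp add: row_prod_def slot_def cst.lext_rename row_mon_rename_Pair)

lemma row_prod_prod_slot:
  "finite W \<Longrightarrow> row_prod L W (\<Prod>i\<in>W. slot i (p i)) = (\<Prod>i\<in>W. lext cst L (p i))"
proof (induction rule: finite_induct)
  case empty
  then show ?case by (simp add: row_prod_def lext_def cst.c_1)
next
  case (insert w W)
  have "row_prod L ({w} \<union> W) (slot w (p w) * (\<Prod>i\<in>W. slot i (p i))) =
      row_prod L {w} (slot w (p w)) * row_prod L W (\<Prod>i\<in>W. slot i (p i))"
    using insert.hyps
    by (intro row_prod_mult) (auto intro!: in_vars_prod in_vars_slot in_vars_UNIV)
  thus ?case using insert by (simp add: row_prod_slot)
qed

section \<open>Degree bounds, listings of monomials and multidegrees of products\<close>

definition deg_le :: "nat \<Rightarrow> 'k::comm_ring_1 mpoly \<Rightarrow> bool" where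
  "deg_le D p \<longleftrightarrow> (\<forall>m\<in>Poly_Mapping.keys p. mon_deg m \<le> D)"

lemma total_deg_le_iff: "total_deg p \<le> D \<longleftrightarrow> deg_le D p"
  by (auto simp: total_deg_def deg_le_def)

lemma deg_le_sum: "(\<And>x. x \<in> S \<Longrightarrow> deg_le D (f x)) \<Longrightarrow> deg_le D (\<Sum>x\<in>S. f x)"
  using keys_sum_subset[of f S] by (fastforce simp: deg_le_def)

lemma deg_le_mult: "deg_le D p \<Longrightarrow> deg_le D' q \<Longrightarrow> deg_le (D + D') (p * q)"
  using keys_mult[of p q] by (fastforce simp: deg_le_def intro: add_mono)

lemma deg_le_cst: "deg_le 0 (cst a)"
  by (simp add: deg_le_def cst_def)

lemma deg_le_var: "deg_le 1 (var v)"
  by (simp add: deg_le_def var_def mon_deg_def)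

lemma deg_le_prod: "finite W \<Longrightarrow> (\<And>i. i \<in> W \<Longrightarrow> deg_le 1 (f i)) \<Longrightarrow> deg_le (card W) (\<Prod>i\<in>W. f i)"
proof (induction rule: finite_induct)
  case empty
  then show ?case using deg_le_cst[of 1] by (simp add: cst.c_1)
next
  case (insert w W)
  then show ?case using deg_le_mult[of 1 "f w" "card W"] by simp
qed

lemma monomial_listing:
  "\<exists>j. (\<forall>k<mon_deg m. j k \<in> Poly_Mapping.keys m) \<and> m = (\<Sum>k<mon_deg m. Poly_Mapping.single (j k) 1)"
proof (induction "mon_deg m" arbitrary: m)
  case 0
  hence "m = 0" by simp
  thus ?case by simp
next
  case (Suc e)
  hence "m \<noteq> 0" by force
  then obtain v where v: "v \<in> Poly_Mapping.keys m"
    by (metis poly_mapping_eqI lookup_zero in_keys_iff)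
  define m' where "m' = m - Poly_Mapping.single v 1"
  have m: "m = m' + Poly_Mapping.single v 1"
    using v by (intro poly_mapping_eqI)
      (auto simp: m'_def lookup_add minus_poly_mapping.rep_eq lookup_single when_def in_keys_iff)
  have "mon_deg (Poly_Mapping.single v 1 :: nat \<Rightarrow>\<^sub>0 nat) = 1" by (simp add: mon_deg_def)
  hence deg: "mon_deg m' = e" using Suc.hyps(2) m by simp
  then obtain j where j: "\<forall>k<e. j k \<in> Poly_Mapping.keys m'" "m' = (\<Sum>k<e. Poly_Mapping.single (j k) 1)"
    using Suc.hyps(1)[of m'] by auto
  have "m = (\<Sum>k<Suc e. Poly_Mapping.single ((j(e := v)) k) 1)"
    using j(2) m by (simp add: sum.cong[of "{..<e}" "{..<e}" "\<lambda>k. Poly_Mapping.single ((j(e := v)) k) 1"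
          "\<lambda>k. Poly_Mapping.single (j k) 1"])
  moreover have "\<forall>k<Suc e. (j(e := v)) k \<in> Poly_Mapping.keys m"
    using j(1) v by (auto simp: less_Suc_eq m keys_add_nat)
  ultimately show ?case unfolding Suc.hyps(2)[symmetric] by blast
qed

lemma multihom_slot:
  assumes "p \<in> homog_of_deg n d"
  shows "multihom (\<lambda>k. if k = i then d else 0) (slot i p)"
  unfolding multihom_def
proof (intro ballI allI)
  fix m k assume m: "m \<in> Poly_Mapping.keys (slot i p)"
  obtain m' where "m' \<in> Poly_Mapping.keys p" "m = mon_rename (Pair i) m'" using keys_slot[OF m] by blast
  thus "mon_deg (row k m) = (if k = i then d else 0)"
    using assms by (auto simp: row_mon_rename_Pair homog_of_deg_def)
qed

lemma multihom_prod_slot: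
  assumes "finite W" "\<And>i. i \<in> W \<Longrightarrow> p i \<in> homog_of_deg n d"
  shows "multihom (\<lambda>k. if k \<in> W then d else 0) (\<Prod>i\<in>W. slot i (p i))"
  using assms
proof (induction rule: finite_induct)
  case empty
  then show ?case by (simp add: multihom_def)
next
  case (insert w W)
  have "multihom (\<lambda>k. (if k = w then d else 0) + (if k \<in> W then d else 0)) (slot w (p w) * (\<Prod>i\<in>W. slot i (p i)))"
    using insert by (intro multihom_mult multihom_slot) auto
  moreover have "(\<lambda>k. (if k = w then d else 0) + (if k \<in> W then d else 0)) = (\<lambda>k. if k \<in> insert w W then d else 0)"
    using insert.hyps by (auto simp: fun_eq_iff)
  ultimately show ?case using insert.hyps by simp
qed

lemma rename_perm_prod_slot:
  assumes "\<sigma> permutes W"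
  shows "rename (apfst \<sigma>) (\<Prod>i\<in>W. slot i (p i)) = (\<Prod>i\<in>W. slot i (p (inv \<sigma> i)))"
  using prod.reindex_bij_betw[OF permutes_imp_bij[OF assms], of "\<lambda>i. slot i (p (inv \<sigma> i))"]
  by (simp add: rename_prod rename_apfst_slot permutes_inverses[OF assms])

text \<open>Equal fibre sizes mean that both maps have the same multiset of values on
  \<open>A\<close>.\<close>

lemma ex_perm_of_equal_fibres:
  assumes "finite A" "\<And>l. card {k\<in>A. \<phi> k = l} = card {k\<in>A. \<psi> k = l}"
  shows "\<exists>\<sigma>. \<sigma> permutes A \<and> (\<forall>k\<in>A. \<phi> k = \<psi> (\<sigma> k))"
proof -
  have "image_mset \<phi> (mset_set A) = image_mset \<psi> (mset_set A)"
    by (rule multiset_eqI) (simp only: count_image_mset_eq_card_vimage[OF assms(1)] assms(2))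
  thus ?thesis using image_mset_eq_implies_permutes[OF assms(1)] by metis
qed

text \<open>Truncating \<open>\<mu>\<close> to degree \<open>s\<close> amounts to applying
  \<open>\<mu>\<close> to the component \<open>hcomp s p\<close>, which stays in \<open>I\<close>
  because \<open>I\<close> is homogeneous.\<close>

lemma annihilator_truncate:
  assumes "conical n I" "\<mu> \<in> annihilator I"
  shows "(\<lambda>m. if mon_deg m = s then \<mu> m else 0) \<in> annihilator I"
proof -
  have "lext (\<lambda>x. x) (\<lambda>m. if mon_deg m = s then \<mu> m else 0) p = 0" if "p \<in> I" for p
  proof -
    have "lext (\<lambda>x. x) (\<lambda>m. if mon_deg m = s then \<mu> m else 0) p = lext (\<lambda>x. x) \<mu> (hcomp s p)"
    proof -
      have "lext (\<lambda>x. x) \<mu> (hcomp s p) =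
          (\<Sum>m\<in>{m\<in>Poly_Mapping.keys p. mon_deg m = s}. Poly_Mapping.lookup p m * \<mu> m)"
        by (simp add: hcomp_def scal.lext_sum scal.lext_single)
      also have "\<dots> = (\<Sum>m\<in>Poly_Mapping.keys p. if mon_deg m = s then Poly_Mapping.lookup p m * \<mu> m else 0)"
        by (simp add: sum.If_cases Int_def)
      also have "\<dots> = lext (\<lambda>x. x) (\<lambda>m. if mon_deg m = s then \<mu> m else 0) p"
        unfolding lext_def by (rule sum.cong) auto
      finally show ?thesis by simp
    qed
    thus ?thesis using assms that by (auto simp: conical_def annihilator_def)
  qed
  thus ?thesis by (simp add: annihilator_def)
qed

text \<open>All monomials of \<open>F\<close> share one multidegree, so truncated functionals see
  either the whole of \<open>F\<close> or nothing.\<close>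

lemma tensor_app_truncate:
  assumes "multihom \<delta> F"
  shows "tensor_app r (\<lambda>l m. if mon_deg m = s l then \<Lambda> l m else 0) F =
    (if \<forall>l<r. \<delta> l = s l then tensor_app r \<Lambda> F else 0)"
proof (cases "\<forall>l<r. \<delta> l = s l")
  case True
  have "tensor_app r (\<lambda>l m. if mon_deg m = s l then \<Lambda> l m else 0) F = tensor_app r \<Lambda> F"
    unfolding tensor_app_def
    by (rule lext_cong, rule prod.cong) (use assms True in \<open>auto simp: multihom_def\<close>)
  thus ?thesis using True by simp
next
  case False
  then obtain l where l: "l < r" "\<delta> l \<noteq> s l" by blast
  have "tensor_app r (\<lambda>l m. if mon_deg m = s l then \<Lambda> l m else 0) F = lext (\<lambda>x. x) (\<lambda>_. 0) F"
    unfolding tensor_app_def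
  proof (rule lext_cong)
    fix m assume "m \<in> Poly_Mapping.keys F"
    thus "(\<Prod>l<r. if mon_deg (row l m) = s l then \<Lambda> l (row l m) else 0) = 0"
      using l assms by (intro prod_zero) (auto simp: multihom_def intro!: bexI[of _ l])
  qed
  also have "\<dots> = 0" by (simp add: lext_def)
  finally show ?thesis unfolding if_not_P[OF False] .
qed

section \<open>The secant ideal in terms of a basis of B_d\<close>

locale veronese_basis =
  fixes n N d r :: nat and I :: "'k::field_char_0 mpoly set" and b :: "nat \<Rightarrow> 'k mpoly"
  assumes conical: "conical n I" and d: "d \<ge> 1" and r: "r \<ge> 1" and basis: "basis_mod n I d N b"
begin

lemma I: "is_ideal_in (poly_ring n) I"
  using conical by (simp add: conical_def)

lemma I_add: "p \<in> I \<Longrightarrow> q \<in> I \<Longrightarrow> p + q \<in> I" and I_0: "0 \<in> I" and I_cst: "p \<in> I \<Longrightarrow> cst a * p \<in> I"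
  using I by (auto simp: is_ideal_in_def poly_ring_eq)

lemma I_sum: "(\<And>x. x \<in> S \<Longrightarrow> f x \<in> I) \<Longrightarrow> (\<Sum>x\<in>S. f x) \<in> I"
  by (induction S rule: infinite_finite_induct) (auto simp: I_add I_0)

lemma b_homog: "j < N \<Longrightarrow> b j \<in> homog_of_deg n d"
  using basis by (simp add: basis_mod_def)

lemma b_poly: "j < N \<Longrightarrow> b j \<in> poly_ring n"
  using b_homog by (auto simp: homog_of_deg_def)

definition coord :: "(nat \<Rightarrow>\<^sub>0 nat) \<Rightarrow> nat \<Rightarrow> 'k" where
  "coord m = (SOME c. Poly_Mapping.single m 1 - (\<Sum>j<N. mconst (c j) * b j) \<in> I)"

text \<open>The class of \<open>m\<close> in B_d as an element of Sym(B_d). It is meaningful for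
  monomials of degree \<open>d\<close> in the first \<open>n\<close> variables; elsewhere
  \<open>coord\<close> may be an arbitrary choice.\<close>

definition lin :: "(nat \<Rightarrow>\<^sub>0 nat) \<Rightarrow> 'k mpoly" where
  "lin m = (\<Sum>j<N. cst (coord m j) * var j)"

lemma lin_poly: "lin m \<in> poly_ring N"
  by (auto simp: lin_def poly_ring_eq intro!: in_vars_sum in_vars_mult in_vars_var)

lemma deg_le_lin: "deg_le 1 (lin m)"
  unfolding lin_def using deg_le_mult[OF deg_le_cst deg_le_var] by (intro deg_le_sum) simp

lemma lin_mod:
  assumes "Poly_Mapping.keys m \<subseteq> {..<n}" "mon_deg m = d"
  shows "Poly_Mapping.single m 1 - subst b (lin m) \<in> I"
proof -
  have "Poly_Mapping.single m (1::'k) \<in> homog_of_deg n d"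
    using assms by (simp add: homog_of_deg_def poly_ring_def)
  hence "\<exists>c. Poly_Mapping.single m 1 - (\<Sum>j<N. mconst (c j) * b j) \<in> I"
    using basis by (auto simp: basis_mod_def)
  hence "Poly_Mapping.single m 1 - (\<Sum>j<N. mconst (coord m j) * b j) \<in> I"
    unfolding coord_def by (rule someI_ex)
  thus ?thesis by (simp add: lin_def subst_sum subst_mult mconst_eq_cst)
qed

lemma lext_lin_mod:
  assumes "p \<in> homog_of_deg n d"
  shows "p - subst b (lext cst lin p) \<in> I"
proof -
  have "p = (\<Sum>m\<in>Poly_Mapping.keys p. cst (Poly_Mapping.lookup p m) * Poly_Mapping.single m 1)"
    by (simp add: cst_mult_single flip: poly_mapping_expand)
  hence "p - subst b (lext cst lin p) =
      (\<Sum>m\<in>Poly_Mapping.keys p. cst (Poly_Mapping.lookup p m) * Poly_Mapping.single m 1) -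
      (\<Sum>m\<in>Poly_Mapping.keys p. cst (Poly_Mapping.lookup p m) * subst b (lin m))"
    by (simp add: lext_def subst_sum subst_mult)
  also have "\<dots> = (\<Sum>m\<in>Poly_Mapping.keys p. cst (Poly_Mapping.lookup p m) *
      (Poly_Mapping.single m 1 - subst b (lin m)))"
    by (simp add: right_diff_distrib sum_subtractf)
  also have "\<dots> \<in> I"
    using assms by (intro I_sum I_cst lin_mod) (auto simp: homog_of_deg_def poly_ring_def)
  finally show ?thesis .
qed

text \<open>The chosen coordinates represent \<open>b j\<close> modulo \<open>I\<close>; linear
  independence of the classes of the basis then makes the linear form exactly
  \<open>var j\<close>.\<close>

lemma lext_lin_b:
  assumes "j < N"
  shows "lext cst lin (b j) = var j"
proof -
  define e where "e i = (\<Sum>m\<in>Poly_Mapping.keys (b j). Poly_Mapping.lookup (b j) m * coord m i)" for i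
  have cst_sum: "cst (\<Sum>x\<in>S. f x) = (\<Sum>x\<in>S. cst (f x))" for S and f :: "(nat \<Rightarrow>\<^sub>0 nat) \<Rightarrow> 'k"
    by (induction S rule: infinite_finite_induct) (auto simp: cst.c_add cst.c_0)
  have eq: "lext cst lin (b j) = (\<Sum>i<N. cst (e i) * var i)"
    unfolding lext_def lin_def e_def cst_sum sum_distrib_left sum_distrib_right
    by (subst sum.swap) (simp add: cst.c_mult mult.assoc)
  have delta: "(\<Sum>i<N. cst (if i = j then 1 else 0) * h i) = h j" for h :: "nat \<Rightarrow> 'k mpoly"
  proof -
    have "(\<Sum>i<N. cst (if i = j then 1 else 0) * h i) = (\<Sum>i<N. if i = j then h i else 0)"
      by (rule sum.cong) (auto simp: cst.c_1 cst.c_0)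
    thus ?thesis using assms by simp
  qed
  have "(\<Sum>i<N. mconst ((if i = j then 1 else 0) - e i) * b i) =
      (\<Sum>i<N. cst (if i = j then 1 else 0) * b i) - (\<Sum>i<N. cst (e i) * b i)"
    by (simp add: mconst_eq_cst left_diff_distrib sum_subtractf cst_def single_diff)
  also have "\<dots> = b j - subst b (lext cst lin (b j))"
    unfolding delta eq by (simp add: subst_sum subst_mult)
  also have "\<dots> \<in> I" by (rule lext_lin_mod[OF b_homog[OF assms]])
  finally have in_I: "(\<Sum>i<N. mconst ((if i = j then 1 else 0) - e i) * b i) \<in> I" .
  have indep: "(\<Sum>i<N. mconst (c i) * b i) \<in> I \<longrightarrow> (\<forall>i<N. c i = 0)" for c
    using basis by (simp add: basis_mod_def)
  have "\<forall>i<N. (if i = j then 1 else 0) - e i = 0"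
    using indep[of "\<lambda>i. (if i = j then 1 else 0) - e i"] in_I by (rule mp)
  hence "(\<Sum>i<N. cst (e i) * var i) = (\<Sum>i<N. cst (if i = j then 1 else 0) * (var i :: 'k mpoly))"
    by (intro sum.cong) auto
  thus ?thesis using eq delta by simp
qed

definition kernel :: "'k mpoly set" where
  "kernel = {q \<in> poly_ring N. secant_map r b q \<in> tensor_ideal I r}"

lemma sec_ideal_eq_kernel: "sec_ideal I N b r = kernel"
  unfolding sec_ideal_def kernel_def by (rule join_pow_eq_kernel[OF I b_poly r])

lemma secant_map_lin:
  assumes "Poly_Mapping.keys m \<subseteq> {..<n}" "mon_deg m = d"
  shows "secant_map r b (lin m) - (\<Sum>l<r. slot l (Poly_Mapping.single m 1)) \<in> tensor_ideal I r"
proof -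
  have "secant_map r b (lin m) = (\<Sum>l<r. slot l (subst b (lin m)))"
    by (simp add: secant_map_def lin_def subst_sum subst_mult slot_sum slot_mult sum_distrib_left
        slot_def rename_sum rename_mult) (rule sum.swap)
  hence "secant_map r b (lin m) - (\<Sum>l<r. slot l (Poly_Mapping.single m 1)) =
      cst (-1) * (\<Sum>l<r. slot l (Poly_Mapping.single m 1 - subst b (lin m)))"
    by (simp add: slot_def rename_diff sum_subtractf cst_uminus cst.c_1)
  also have "\<dots> \<in> tensor_ideal I r"
    using lin_mod[OF assms] by (intro tensor_ideal_cst_mult tensor_ideal_sum slot_in_tensor_ideal) auto
  finally show ?thesis .
qed

text \<open>Modulo the ideal, each \<open>lin\<close> becomes the sum of the copies of its monomial.
  Multiplying out over the rows in \<open>W\<close> chooses a copy for each row, which is a map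
  \<open>\<psi>\<close> applied to the rows of \<open>F\<close>.\<close>

lemma secant_map_row_prod:
  assumes W: "finite W" and F: "in_vars (W \<times> {..<n}) F" "multihom \<delta> F" "\<And>i. i \<in> W \<Longrightarrow> \<delta> i = d"
  shows "secant_map r b (row_prod lin W F) - (\<Sum>\<psi>\<in>W \<rightarrow>\<^sub>E {..<r}. rename (apfst \<psi>) F) \<in> tensor_ideal I r"
proof -
  have mono: "secant_map r b (\<Prod>i\<in>W. lin (row i m)) -
      (\<Sum>\<psi>\<in>W \<rightarrow>\<^sub>E {..<r}. rename (apfst \<psi>) (Poly_Mapping.single m 1)) \<in> tensor_ideal I r"
    if m: "m \<in> Poly_Mapping.keys F" for m
  proof -
    have mW: "Poly_Mapping.keys m \<subseteq> W \<times> {..<n}" using F(1) m by (auto simp: in_vars_def)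
    hence mW': "Poly_Mapping.keys m \<subseteq> W \<times> UNIV" by auto
    have "(\<Sum>\<psi>\<in>W \<rightarrow>\<^sub>E {..<r}. rename (apfst \<psi>) (Poly_Mapping.single m (1::'k))) =
        (\<Sum>\<psi>\<in>W \<rightarrow>\<^sub>E {..<r}. \<Prod>i\<in>W. slot (\<psi> i) (Poly_Mapping.single (row i m) 1))"
      by (simp add: single_eq_prod_slot[OF W mW'] rename_prod rename_apfst_slot)
    also have "\<dots> = (\<Prod>i\<in>W. \<Sum>l<r. slot l (Poly_Mapping.single (row i m) 1))"
      by (rule prod_sum_PiE[OF W, symmetric]) simp
    finally have eq: "(\<Sum>\<psi>\<in>W \<rightarrow>\<^sub>E {..<r}. rename (apfst \<psi>) (Poly_Mapping.single m (1::'k))) =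
        (\<Prod>i\<in>W. \<Sum>l<r. slot l (Poly_Mapping.single (row i m) 1))" .
    have "secant_map r b (\<Prod>i\<in>W. lin (row i m)) = (\<Prod>i\<in>W. secant_map r b (lin (row i m)))"
      by (simp add: secant_map_def subst_prod)
    moreover have "(\<Prod>i\<in>W. secant_map r b (lin (row i m))) -
        (\<Prod>i\<in>W. \<Sum>l<r. slot l (Poly_Mapping.single (row i m) 1)) \<in> tensor_ideal I r"
    proof (rule tensor_ideal_prod_cong[OF I W])
      fix i assume i: "i \<in> W"
      show "secant_map r b (lin (row i m)) - (\<Sum>l<r. slot l (Poly_Mapping.single (row i m) 1)) \<in> tensor_ideal I r"
        using F(2,3) m i by (intro secant_map_lin keys_row[OF mW]) (auto simp: multihom_def)
      show "in_vars (UNIV \<times> {..<n}) (secant_map r b (lin (row i m)))"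
        using in_vars_secant_map[OF lin_poly b_poly] by (rule in_vars_mono) auto
      show "in_vars (UNIV \<times> {..<n}) (\<Sum>l<r. slot l (Poly_Mapping.single (row i m) (1::'k)))"
        by (intro in_vars_sum in_vars_slot in_vars_single keys_row[OF mW]) auto
    qed
    ultimately show ?thesis by (simp add: eq)
  qed
  have "secant_map r b (row_prod lin W F) - (\<Sum>\<psi>\<in>W \<rightarrow>\<^sub>E {..<r}. rename (apfst \<psi>) F) =
     (\<Sum>m\<in>Poly_Mapping.keys F. cst (Poly_Mapping.lookup F m) * (secant_map r b (\<Prod>i\<in>W. lin (row i m)) -
      (\<Sum>\<psi>\<in>W \<rightarrow>\<^sub>E {..<r}. rename (apfst \<psi>) (Poly_Mapping.single m 1))))"
  proof -
    have "rename (apfst \<psi>) F = (\<Sum>m\<in>Poly_Mapping.keys F. cst (Poly_Mapping.lookup F m) *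
        rename (apfst \<psi>) (Poly_Mapping.single m 1))" for \<psi> :: "nat \<Rightarrow> nat"
    proof -
      have "rename (apfst \<psi>) F = rename (apfst \<psi>) (\<Sum>m\<in>Poly_Mapping.keys F.
          Poly_Mapping.single m (Poly_Mapping.lookup F m))"
        by (simp flip: poly_mapping_expand)
      thus ?thesis by (simp add: rename_sum rename_single cst_mult_single)
    qed
    hence "(\<Sum>\<psi>\<in>W \<rightarrow>\<^sub>E {..<r}. rename (apfst \<psi>) F) =
      (\<Sum>m\<in>Poly_Mapping.keys F. cst (Poly_Mapping.lookup F m) *
        (\<Sum>\<psi>\<in>W \<rightarrow>\<^sub>E {..<r}. rename (apfst \<psi>) (Poly_Mapping.single m 1)))"
      by (simp add: sum_distrib_left) (rule sum.swap)
    thus ?thesis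
      by (simp add: row_prod_def lext_def secant_map_def subst_sum subst_mult right_diff_distrib sum_subtractf)
  qed
  also have "\<dots> \<in> tensor_ideal I r"
    by (intro tensor_ideal_sum tensor_ideal_cst_mult mono)
  finally show ?thesis .
qed

lemma row_prod_poly: "row_prod lin W F \<in> poly_ring N"
  using lin_poly by (auto simp: row_prod_def poly_ring_eq intro!: in_vars_lext in_vars_prod)

lemma deg_le_row_prod: "finite W \<Longrightarrow> deg_le (card W) (row_prod lin W F)"
  unfolding row_prod_def lext_def
  using deg_le_mult[OF deg_le_cst deg_le_prod] deg_le_lin by (intro deg_le_sum) fastforce

lemma row_prod_in_kernel:
  assumes W: "finite W" and F: "F \<in> row_relations n I r"
    and hom: "multihom (\<lambda>i. if i \<in> W then d else 0) F"
  shows "row_prod lin W F \<in> kernel"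
proof -
  have vars: "in_vars (W \<times> {..<n}) F"
    by (rule in_vars_of_multihom[OF _ hom]) (use F in \<open>auto simp: row_relations_def\<close>)
  have "rename (apfst \<psi>) F \<in> tensor_ideal I r" if \<psi>: "\<psi> \<in> W \<rightarrow>\<^sub>E {..<r}" for \<psi>
  proof -
    \<comment> \<open>Outside \<open>W\<close> the value of \<open>\<psi>\<close> is
      \<open>undefined\<close>, perhaps not below \<open>r\<close>. It is replaced by 0, an
      admissible value as \<open>r \<ge> 1\<close>; \<open>F\<close> has no variables in those
      rows.\<close>
    define \<psi>' where "\<psi>' i = (if i \<in> W then \<psi> i else 0)" for i
    have "range \<psi>' \<subseteq> {..<r}" using \<psi> r by (auto simp: \<psi>'_def)
    hence "rename (apfst \<psi>') F \<in> tensor_ideal I r" using F by (simp add: row_relations_def)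
    moreover have "rename (apfst \<psi>') F = rename (apfst \<psi>) F"
      by (rule rename_apfst_cong[OF in_vars_mono[OF vars]]) (auto simp: \<psi>'_def)
    ultimately show ?thesis by simp
  qed
  hence "(\<Sum>\<psi>\<in>W \<rightarrow>\<^sub>E {..<r}. rename (apfst \<psi>) F) \<in> tensor_ideal I r" by (rule tensor_ideal_sum)
  with secant_map_row_prod[OF W vars hom] have "secant_map r b (row_prod lin W F) \<in> tensor_ideal I r"
    using tensor_ideal_add by fastforce
  thus ?thesis by (simp add: kernel_def row_prod_poly)
qed

end

definition listing :: "(nat \<Rightarrow>\<^sub>0 nat) \<Rightarrow> nat \<Rightarrow> nat" where
  "listing m = (SOME j. (\<forall>k<mon_deg m. j k \<in> Poly_Mapping.keys m) \<and>
      m = (\<Sum>k<mon_deg m. Poly_Mapping.single (j k) 1))"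

lemma listing: "(\<forall>k<mon_deg m. listing m k \<in> Poly_Mapping.keys m) \<and>
    m = (\<Sum>k<mon_deg m. Poly_Mapping.single (listing m k) 1)"
  unfolding listing_def by (rule someI_ex[OF monomial_listing])

lemma single_eq_prod_listing: "Poly_Mapping.single m a = cst a * (\<Prod>k<mon_deg m. var (listing m k))"
proof -
  have "Poly_Mapping.single m 1 = (\<Prod>k<mon_deg m. var (listing m k) :: ((nat \<Rightarrow>\<^sub>0 nat) \<Rightarrow>\<^sub>0 'a))"
    unfolding var_def single_sum_exponent using listing[of m] by simp
  thus ?thesis by (metis cst_mult_single mult.right_neutral)
qed

context veronese_basis
begin

text \<open>The factors of \<open>m\<close>, in a chosen order, are put into successive rows; this
  is a polarization not yet symmetrized.\<close>

definition block :: "(nat \<Rightarrow>\<^sub>0 nat) \<Rightarrow> (nat \<times> nat \<Rightarrow>\<^sub>0 nat) \<Rightarrow>\<^sub>0 'k" where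
  "block m = (\<Prod>k<mon_deg m. slot k (b (listing m k)))"

text \<open>The polarization of the degree \<open>e\<close> component of \<open>q\<close>: averaging
  over all permutations of the rows makes it symmetric.\<close>

definition polar :: "'k mpoly \<Rightarrow> nat \<Rightarrow> (nat \<times> nat \<Rightarrow>\<^sub>0 nat) \<Rightarrow>\<^sub>0 'k" where
  "polar q e = (\<Sum>m\<in>{m\<in>Poly_Mapping.keys q. mon_deg m = e}.
     cst (Poly_Mapping.lookup q m / fact e) * (\<Sum>\<sigma>\<in>{\<sigma>. \<sigma> permutes {..<e}}. rename (apfst \<sigma>) (block m)))"

lemma listing_less: "q \<in> poly_ring N \<Longrightarrow> m \<in> Poly_Mapping.keys q \<Longrightarrow> k < mon_deg m \<Longrightarrow> listing m k < N"
  using listing[of m] by (auto simp: poly_ring_def)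

lemma multihom_cst_mult: "multihom \<delta> F \<Longrightarrow> multihom \<delta> (cst a * F)" for F :: "(nat \<times> nat \<Rightarrow>\<^sub>0 nat) \<Rightarrow>\<^sub>0 'k"
  by (auto simp: multihom_def lookup_cst_mult in_keys_iff)

lemma sum_by_degree:
  "(\<Sum>m\<in>Poly_Mapping.keys q. h m) =
    (\<Sum>e\<in>mon_deg ` Poly_Mapping.keys q. \<Sum>m\<in>{m\<in>Poly_Mapping.keys q. mon_deg m = e}. h m)"
  by (rule sum.group[symmetric]) auto

context
  fixes q :: "'k mpoly"
  assumes q: "q \<in> poly_ring N"
begin

lemma rename_perm_block:
  assumes "\<sigma> permutes {..<mon_deg m}"
  shows "rename (apfst \<sigma>) (block m) = (\<Prod>i<mon_deg m. slot i (b (listing m (inv \<sigma> i))))"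
  unfolding block_def by (rule rename_perm_prod_slot[OF assms])

lemma inv_perm_less: "\<sigma> permutes {..<e} \<Longrightarrow> i < e \<Longrightarrow> inv \<sigma> i < e" for e :: nat
  using permutes_in_image[OF permutes_inv, of \<sigma> "{..<e}" i] by simp

lemma polar_vars: "in_vars ({..<e} \<times> {..<n}) (polar q e)"
  unfolding polar_def
proof (intro in_vars_sum in_vars_mult in_vars_cst)
  fix m \<sigma> assume m: "m \<in> {m\<in>Poly_Mapping.keys q. mon_deg m = e}" and \<sigma>: "\<sigma> \<in> {\<sigma>. \<sigma> permutes {..<e}}"
  have "b (listing m (inv \<sigma> i)) \<in> poly_ring n" if "i < e" for i
    using m \<sigma> that by (intro b_poly listing_less[OF q]) (auto intro: inv_perm_less)
  hence "in_vars ({..<e} \<times> {..<n}) (\<Prod>i<e. slot i (b (listing m (inv \<sigma> i))))"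
    by (intro in_vars_prod in_vars_slot) (auto simp: poly_ring_eq)
  thus "in_vars ({..<e} \<times> {..<n}) (rename (apfst \<sigma>) (block m))"
    using m \<sigma> by (simp add: rename_perm_block)
qed

lemma polar_multihom: "multihom (\<lambda>i. if i \<in> {..<e} then d else 0) (polar q e)"
  unfolding polar_def
proof (intro multihom_sum multihom_cst_mult)
  fix m \<sigma> assume m: "m \<in> {m\<in>Poly_Mapping.keys q. mon_deg m = e}" and \<sigma>: "\<sigma> \<in> {\<sigma>. \<sigma> permutes {..<e}}"
  have "multihom (\<lambda>i. if i \<in> {..<e} then d else 0) (\<Prod>i<e. slot i (b (listing m (inv \<sigma> i))))"
    using m \<sigma> by (intro multihom_prod_slot[where n = n] b_homog listing_less[OF q]) (auto intro: inv_perm_less)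
  thus "multihom (\<lambda>i. if i \<in> {..<e} then d else 0) (rename (apfst \<sigma>) (block m))"
    using m \<sigma> by (simp add: rename_perm_block)
qed

text \<open>Depolarization undoes polarization: each permuted block returns the monomial
  \<open>m\<close>, and the number of permutations cancels \<open>fact e\<close>.\<close>

lemma row_prod_polar:
  "row_prod lin {..<e} (polar q e) =
    (\<Sum>m\<in>{m\<in>Poly_Mapping.keys q. mon_deg m = e}. Poly_Mapping.single m (Poly_Mapping.lookup q m))"
proof -
  have "cst (Poly_Mapping.lookup q m / fact e) *
      (\<Sum>\<sigma>\<in>{\<sigma>. \<sigma> permutes {..<e}}. row_prod lin {..<e} (rename (apfst \<sigma>) (block m))) =
      Poly_Mapping.single m (Poly_Mapping.lookup q m)"
    if m: "m \<in> {m\<in>Poly_Mapping.keys q. mon_deg m = e}" for m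
  proof -
    have "row_prod lin {..<e} (rename (apfst \<sigma>) (block m)) = Poly_Mapping.single m 1"
      if \<sigma>: "\<sigma> permutes {..<e}" for \<sigma>
    proof -
      have "row_prod lin {..<e} (rename (apfst \<sigma>) (block m)) =
          (\<Prod>i<e. lext cst lin (b (listing m (inv \<sigma> i))))"
        using m \<sigma> by (simp add: rename_perm_block row_prod_prod_slot)
      also have "\<dots> = (\<Prod>i<e. var (listing m (inv \<sigma> i)))"
        using m \<sigma> by (intro prod.cong refl lext_lin_b listing_less[OF q]) (auto intro: inv_perm_less)
      also have "\<dots> = (\<Prod>i<e. var (listing m i))"
        by (rule prod.reindex_bij_betw) (rule permutes_imp_bij[OF permutes_inv[OF \<sigma>]])
      also have "\<dots> = Poly_Mapping.single m 1"
        using m by (simp add: single_eq_prod_listing cst.c_1)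
      finally show ?thesis .
    qed
    hence "(\<Sum>\<sigma>\<in>{\<sigma>. \<sigma> permutes {..<e}}. row_prod lin {..<e} (rename (apfst \<sigma>) (block m))) =
        of_nat (card {\<sigma>. \<sigma> permutes {..<e}}) * Poly_Mapping.single m 1" by simp
    also have "\<dots> = cst (fact e) * Poly_Mapping.single m 1"
      by (simp add: card_permutations[of _ e] flip: cst_of_nat)
    finally show ?thesis by (simp add: cst_mult_single)
  qed
  thus ?thesis unfolding polar_def row_prod_sum row_prod_cst_mult by (intro sum.cong refl)
qed

lemma polar_symmetric:
  assumes \<tau>: "\<tau> permutes {..<e}"
  shows "rename (apfst \<tau>) (polar q e) = polar q e"
proof -
  have "(\<Sum>\<sigma>\<in>{\<sigma>. \<sigma> permutes {..<e}}. rename (apfst \<tau>) (rename (apfst \<sigma>) (block m))) =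
      (\<Sum>\<sigma>\<in>{\<sigma>. \<sigma> permutes {..<e}}. rename (apfst \<sigma>) (block m))" for m
    unfolding rename_apfst_comp by (rule setum_permutations_compose_left[OF \<tau>, symmetric])
  thus ?thesis by (simp add: polar_def rename_sum rename_mult)
qed

text \<open>Multiplying out gives the sum over all \<open>\<psi>\<close> applied to blocks.
  Replacing blocks by their averages leaves this sum unchanged, since
  \<open>\<psi> \<circ> \<sigma>\<close> runs through the same maps as
  \<open>\<psi>\<close>.\<close>

lemma secant_map_eq_sum_polar:
  "secant_map r b q = (\<Sum>e\<in>mon_deg ` Poly_Mapping.keys q. \<Sum>\<psi>\<in>{..<e} \<rightarrow>\<^sub>E {..<r}. rename (apfst \<psi>) (polar q e))"
proof -
  have single: "secant_map r b (Poly_Mapping.single m a) =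
      cst a * (\<Sum>\<psi>\<in>{..<mon_deg m} \<rightarrow>\<^sub>E {..<r}. rename (apfst \<psi>) (block m))" for m a
  proof -
    have "secant_map r b (Poly_Mapping.single m a) = cst a * (\<Prod>k<mon_deg m. \<Sum>l<r. slot l (b (listing m k)))"
      by (simp add: single_eq_prod_listing secant_map_def subst_mult subst_prod)
    also have "(\<Prod>k<mon_deg m. \<Sum>l<r. slot l (b (listing m k))) =
        (\<Sum>\<psi>\<in>{..<mon_deg m} \<rightarrow>\<^sub>E {..<r}. \<Prod>k<mon_deg m. slot (\<psi> k) (b (listing m k)))"
      by (rule prod_sum_PiE) auto
    finally show ?thesis by (simp add: block_def rename_prod rename_apfst_slot)
  qed
  have reindex: "(\<Sum>\<psi>\<in>{..<e} \<rightarrow>\<^sub>E {..<r}. rename (apfst (\<psi> \<circ> \<sigma>)) F) = (\<Sum>\<psi>\<in>{..<e} \<rightarrow>\<^sub>E {..<r}. rename (apfst \<psi>) F)"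
    if \<sigma>: "\<sigma> permutes {..<e}" for e \<sigma> and F :: "(nat \<times> nat \<Rightarrow>\<^sub>0 nat) \<Rightarrow>\<^sub>0 'k"
  proof (rule sum.reindex_bij_witness[where i = "\<lambda>\<psi>. \<psi> \<circ> inv \<sigma>" and j = "\<lambda>\<psi>. \<psi> \<circ> \<sigma>"])
    have comp: "\<psi> \<circ> \<tau> \<in> {..<e} \<rightarrow>\<^sub>E {..<r}" if \<psi>: "\<psi> \<in> {..<e} \<rightarrow>\<^sub>E {..<r}" and \<tau>: "\<tau> permutes {..<e}" for \<psi> \<tau>
    proof (rule PiE_I)
      fix x assume "x \<in> {..<e}"
      hence "\<tau> x \<in> {..<e}" using permutes_in_image[OF \<tau>] by blast
      thus "(\<psi> \<circ> \<tau>) x \<in> {..<r}" using \<psi> by auto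
    next
      fix x assume "x \<notin> {..<e}"
      hence "\<tau> x = x" "x \<notin> {..<e}" using permutes_not_in[OF \<tau>] by auto
      thus "(\<psi> \<circ> \<tau>) x = undefined" using PiE_arb[OF \<psi>] by simp
    qed
    fix \<psi> assume \<psi>: "\<psi> \<in> {..<e} \<rightarrow>\<^sub>E {..<r}"
    show "\<psi> \<circ> \<sigma> \<in> {..<e} \<rightarrow>\<^sub>E {..<r}" "\<psi> \<circ> inv \<sigma> \<in> {..<e} \<rightarrow>\<^sub>E {..<r}"
      using comp[OF \<psi>] \<sigma> permutes_inv[OF \<sigma>] by blast+
    show "\<psi> \<circ> \<sigma> \<circ> inv \<sigma> = \<psi>" "\<psi> \<circ> inv \<sigma> \<circ> \<sigma> = \<psi>"
      by (auto simp: fun_eq_iff permutes_inverses[OF \<sigma>])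
  qed auto
  have polar: "(\<Sum>\<psi>\<in>{..<e} \<rightarrow>\<^sub>E {..<r}. rename (apfst \<psi>) (polar q e)) =
      (\<Sum>m\<in>{m\<in>Poly_Mapping.keys q. mon_deg m = e}. secant_map r b (Poly_Mapping.single m (Poly_Mapping.lookup q m)))" for e
  proof -
    have "(\<Sum>\<psi>\<in>{..<e} \<rightarrow>\<^sub>E {..<r}. rename (apfst \<psi>) (polar q e)) =
        (\<Sum>m\<in>{m\<in>Poly_Mapping.keys q. mon_deg m = e}. \<Sum>\<psi>\<in>{..<e} \<rightarrow>\<^sub>E {..<r}.
          cst (Poly_Mapping.lookup q m / fact e) *
          (\<Sum>\<sigma>\<in>{\<sigma>. \<sigma> permutes {..<e}}. rename (apfst (\<psi> \<circ> \<sigma>)) (block m)))"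
      by (simp add: polar_def rename_sum rename_mult rename_apfst_comp) (rule sum.swap)
    also have "\<dots> = (\<Sum>m\<in>{m\<in>Poly_Mapping.keys q. mon_deg m = e}. cst (Poly_Mapping.lookup q m / fact e) *
        (\<Sum>\<sigma>\<in>{\<sigma>. \<sigma> permutes {..<e}}. \<Sum>\<psi>\<in>{..<e} \<rightarrow>\<^sub>E {..<r}. rename (apfst (\<psi> \<circ> \<sigma>)) (block m)))"
      unfolding sum_distrib_left[symmetric] by (subst sum.swap) (rule refl)
    also have "\<dots> = (\<Sum>m\<in>{m\<in>Poly_Mapping.keys q. mon_deg m = e}. cst (Poly_Mapping.lookup q m / fact e) *
        (of_nat (card {\<sigma>. \<sigma> permutes {..<e}}) * (\<Sum>\<psi>\<in>{..<e} \<rightarrow>\<^sub>E {..<r}. rename (apfst \<psi>) (block m))))"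
      by (intro sum.cong refl arg_cong2[where f = "(*)"]) (simp add: reindex)
    also have "\<dots> = (\<Sum>m\<in>{m\<in>Poly_Mapping.keys q. mon_deg m = e}.
        secant_map r b (Poly_Mapping.single m (Poly_Mapping.lookup q m)))"
    proof (intro sum.cong refl)
      fix m assume m: "m \<in> {m\<in>Poly_Mapping.keys q. mon_deg m = e}"
      have "cst (Poly_Mapping.lookup q m / fact e) * (of_nat (card {\<sigma>. \<sigma> permutes {..<e}}) * X) =
          cst (Poly_Mapping.lookup q m) * X" for X :: "(nat \<times> nat \<Rightarrow>\<^sub>0 nat) \<Rightarrow>\<^sub>0 'k"
        by (simp add: card_permutations[of _ e] flip: cst_of_nat mult.assoc cst.c_mult)
      thus "cst (Poly_Mapping.lookup q m / fact e) * (of_nat (card {\<sigma>. \<sigma> permutes {..<e}}) *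
          (\<Sum>\<psi>\<in>{..<e} \<rightarrow>\<^sub>E {..<r}. rename (apfst \<psi>) (block m))) =
          secant_map r b (Poly_Mapping.single m (Poly_Mapping.lookup q m))"
        using m by (simp add: single)
    qed
    finally show ?thesis .
  qed
  have "secant_map r b q = (\<Sum>m\<in>Poly_Mapping.keys q. secant_map r b (Poly_Mapping.single m (Poly_Mapping.lookup q m)))"
    by (subst poly_mapping_expand) (simp add: secant_map_def subst_sum)
  thus ?thesis by (simp add: polar sum_by_degree)
qed

text \<open>Truncating the functionals to fixed degrees singles out the maps \<open>\<psi>\<close> whose fibres have the same
  sizes as those of \<open>\<phi>\<close>; by symmetry all of them contribute the same value.\<close>

lemma polar_in_row_relations:
  assumes ker: "secant_map r b q \<in> tensor_ideal I r" and e: "e \<in> mon_deg ` Poly_Mapping.keys q"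
  shows "polar q e \<in> row_relations n I r"
proof -
  have "tensor_app r \<Lambda> (rename (apfst \<phi>) (polar q e)) = 0"
    if \<phi>: "range \<phi> \<subseteq> {..<r}" and \<Lambda>: "\<forall>l<r. \<Lambda> l \<in> annihilator I" for \<phi> \<Lambda>
  proof -
    let ?D = "mon_deg ` Poly_Mapping.keys q"
    \<comment> \<open>\<open>q\<close> may be inhomogeneous, so maps from the rows of all its
      degrees \<open>e'\<close> have to be separated simultaneously.\<close>
    define S where "S = (SIGMA e':?D. {..<e'} \<rightarrow>\<^sub>E {..<r})"
    define same where "same = (\<lambda>(e' :: nat, \<psi> :: nat \<Rightarrow> nat). \<forall>l<r. card {k\<in>{..<e'}. \<psi> k = l} = card {k\<in>{..<e}. \<phi> k = l})"
    \<comment> \<open>The degree in row \<open>l\<close> after renaming: each of the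
      \<open>e\<close> rows has degree \<open>d\<close>, and the rows of one fibre merge.\<close>
    define s where "s l = card {k\<in>{..<e}. \<phi> k = l} * d" for l
    define \<Lambda>' where "\<Lambda>' l m = (if mon_deg m = s l then \<Lambda> l m else 0)" for l m
    let ?X = "tensor_app r \<Lambda> (rename (apfst \<phi>) (polar q e))"
    have fin: "finite S" unfolding S_def by (intro finite_SigmaI finite_PiE) auto
    have contrib: "tensor_app r \<Lambda>' (rename (apfst \<psi>) (polar q e')) = (if same (e', \<psi>) then ?X else 0)"
      if \<psi>: "\<psi> \<in> {..<e'} \<rightarrow>\<^sub>E {..<r}" for e' \<psi>
    proof -
      have vars: "in_vars ({..<e'} \<times> UNIV) (polar q e')" by (rule in_vars_mono[OF polar_vars]) auto
      have "(\<Sum>i\<in>{i \<in> {..<e'}. \<psi> i = l}. if i \<in> {..<e'} then d else 0) = card {k\<in>{..<e'}. \<psi> k = l} * d" for l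
        by simp
      hence hom: "multihom (\<lambda>l. card {k\<in>{..<e'}. \<psi> k = l} * d) (rename (apfst \<psi>) (polar q e'))"
        using multihom_rename[OF _ vars polar_multihom, of \<psi>] by simp
      have "tensor_app r \<Lambda>' (rename (apfst \<psi>) (polar q e')) =
          (if \<forall>l<r. card {k\<in>{..<e'}. \<psi> k = l} * d = s l
           then tensor_app r \<Lambda> (rename (apfst \<psi>) (polar q e')) else 0)"
        unfolding \<Lambda>'_def by (rule tensor_app_truncate[OF hom])
      \<comment> \<open>Degrees determine fibre sizes because \<open>d \<ge> 1\<close> can be
        cancelled.\<close>
      also have "(\<forall>l<r. card {k\<in>{..<e'}. \<psi> k = l} * d = s l) \<longleftrightarrow> same (e', \<psi>)"
        using d by (auto simp: same_def s_def)
      also have "tensor_app r \<Lambda> (rename (apfst \<psi>) (polar q e')) = ?X" if "same (e', \<psi>)"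
      proof -
        have card_fibres: "(\<Sum>l<r. card {k\<in>{..<a}. f k = l}) = a" if "\<And>k. k < a \<Longrightarrow> f k < r"
          for a :: nat and f :: "nat \<Rightarrow> nat"
        proof -
          have "(\<Sum>l<r. card {k\<in>{..<a}. f k = l}) = (\<Sum>l<r. \<Sum>k\<in>{k\<in>{..<a}. f k = l}. 1)" by simp
          also have "\<dots> = (\<Sum>k<a. 1)" using that by (intro sum.group) auto
          finally show ?thesis by simp
        qed
        \<comment> \<open>The fibres partition the rows, so equal fibre sizes already force
          \<open>e' = e\<close>.\<close>
        have "(\<Sum>l<r. card {k\<in>{..<e'}. \<psi> k = l}) = (\<Sum>l<r. card {k\<in>{..<e}. \<phi> k = l})"
          using \<open>same (e', \<psi>)\<close> by (auto simp: same_def)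
        moreover have "(\<Sum>l<r. card {k\<in>{..<e'}. \<psi> k = l}) = e'" using \<psi> by (intro card_fibres) auto
        moreover have "(\<Sum>l<r. card {k\<in>{..<e}. \<phi> k = l}) = e" using \<phi> by (intro card_fibres) auto
        ultimately have "e' = e" by simp
        have "\<exists>\<sigma>. \<sigma> permutes {..<e} \<and> (\<forall>k\<in>{..<e}. \<phi> k = \<psi> (\<sigma> k))"
        proof (rule ex_perm_of_equal_fibres)
          fix l
          show "card {k\<in>{..<e}. \<phi> k = l} = card {k\<in>{..<e}. \<psi> k = l}"
          proof (cases "l < r")
            case True
            thus ?thesis using \<open>same (e', \<psi>)\<close> \<open>e' = e\<close> by (auto simp: same_def)
          next
            case False
            have "{k\<in>{..<e}. \<phi> k = l} = {}" using \<phi> False by auto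
            moreover have "{k\<in>{..<e}. \<psi> k = l} = {}" using \<psi> False \<open>e' = e\<close> by auto
            ultimately show ?thesis by (simp only: card.empty)
          qed
        qed simp
        then obtain \<sigma> where \<sigma>: "\<sigma> permutes {..<e}" "\<And>k. k < e \<Longrightarrow> \<phi> k = \<psi> (\<sigma> k)" by auto
        have "rename (apfst \<phi>) (polar q e) = rename (apfst (\<psi> \<circ> \<sigma>)) (polar q e)"
          using \<open>e' = e\<close> vars \<sigma>(2) by (intro rename_apfst_cong[of "{..<e}"]) auto
        also have "\<dots> = rename (apfst \<psi>) (rename (apfst \<sigma>) (polar q e))" by (simp add: rename_apfst_comp)
        also have "\<dots> = rename (apfst \<psi>) (polar q e')" by (simp add: polar_symmetric[OF \<sigma>(1)] \<open>e' = e\<close>)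
        finally show ?thesis by simp
      qed
      ultimately show ?thesis by simp
    qed
    have "\<Lambda>' l \<in> annihilator I" if "l < r" for l
      using annihilator_truncate[OF conical, of "\<Lambda> l" "s l"] \<Lambda> that by (simp add: \<Lambda>'_def[abs_def])
    hence "0 = tensor_app r \<Lambda>' (secant_map r b q)" using tensor_idealD[OF ker] by simp
    also have "\<dots> = (\<Sum>e'\<in>?D. \<Sum>\<psi>\<in>{..<e'} \<rightarrow>\<^sub>E {..<r}. tensor_app r \<Lambda>' (rename (apfst \<psi>) (polar q e')))"
      by (simp add: secant_map_eq_sum_polar tensor_app_sum)
    also have "\<dots> = (\<Sum>(e', \<psi>)\<in>S. tensor_app r \<Lambda>' (rename (apfst \<psi>) (polar q e')))"
      unfolding S_def by (rule sum.Sigma) (auto intro: finite_PiE)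
    also have "\<dots> = (\<Sum>x\<in>S. if same x then ?X else 0)"
    proof (rule sum.cong[OF refl])
      fix x assume x: "x \<in> S"
      obtain e' \<psi> where "x = (e', \<psi>)" by (cases x)
      moreover from this x have "\<psi> \<in> {..<e'} \<rightarrow>\<^sub>E {..<r}" by (simp only: S_def mem_Sigma_iff)
      ultimately show "(case x of (e', \<psi>) \<Rightarrow> tensor_app r \<Lambda>' (rename (apfst \<psi>) (polar q e'))) =
          (if same x then ?X else 0)"
        using contrib by (simp only: prod.case)
    qed
    also have "\<dots> = of_nat (card {x\<in>S. same x}) * ?X"
      using fin by (simp add: sum.If_cases Int_def)
    finally have 0: "of_nat (card {x\<in>S. same x}) * ?X = 0" by simp
    \<comment> \<open>\<open>\<phi>\<close> itself is counted, so the multiplicity of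
      \<open>?X\<close> is a positive integer and hence invertible in characteristic 0.\<close>
    have "(e, restrict \<phi> {..<e}) \<in> {x\<in>S. same x}"
    proof -
      have "{k\<in>{..<e}. restrict \<phi> {..<e} k = l} = {k\<in>{..<e}. \<phi> k = l}" for l by auto
      hence "same (e, restrict \<phi> {..<e})" by (simp only: same_def prod.case) simp
      moreover have "restrict \<phi> {..<e} \<in> {..<e} \<rightarrow>\<^sub>E {..<r}" using \<phi> by (auto simp: image_subset_iff)
      ultimately show ?thesis using e by (simp add: S_def)
    qed
    hence "card {x\<in>S. same x} \<noteq> 0" using fin by (subst card_0_eq) auto
    thus ?thesis using 0 by simp
  qed
  hence "\<forall>\<phi>. range \<phi> \<subseteq> {..<r} \<longrightarrow> rename (apfst \<phi>) (polar q e) \<in> tensor_ideal I r"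
    by (simp add: tensor_ideal_def)
  moreover have "in_vars (UNIV \<times> {..<n}) (polar q e)" by (rule in_vars_mono[OF polar_vars]) auto
  ultimately show ?thesis using polar_multihom[of e] by (auto simp: row_relations_def)
qed

lemma sum_row_prod_polar:
  "q = (\<Sum>e\<in>mon_deg ` Poly_Mapping.keys q. row_prod lin {..<e} (polar q e))"
  unfolding row_prod_polar sum_by_degree[symmetric] by (rule poly_mapping_expand)

end

section \<open>Generation of the secant ideal in bounded degree\<close>

lemma kernel_0: "0 \<in> kernel" and kernel_add: "p \<in> kernel \<Longrightarrow> q \<in> kernel \<Longrightarrow> p + q \<in> kernel"
  by (auto simp: kernel_def poly_ring_eq secant_map_def subst_add intro: in_vars_add tensor_ideal_add)

lemma kernel_mult:
  assumes "p \<in> poly_ring N" "q \<in> kernel"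
  shows "p * q \<in> kernel"
proof -
  have "in_vars (UNIV \<times> {..<n}) (secant_map r b p)"
    using in_vars_secant_map[OF assms(1) b_poly] by (rule in_vars_mono) auto
  hence "secant_map r b p * secant_map r b q \<in> tensor_ideal I r"
    using assms by (intro tensor_ideal_mult[OF I]) (auto simp: kernel_def)
  thus ?thesis using assms by (auto simp: kernel_def poly_ring_eq secant_map_def subst_mult in_vars_mult)
qed

lemma kernel_sum: "(\<And>x. x \<in> S \<Longrightarrow> f x \<in> kernel) \<Longrightarrow> (\<Sum>x\<in>S. f x) \<in> kernel"
  by (induction S rule: infinite_finite_induct) (auto simp: kernel_0 kernel_add)

text \<open>The rows are divided into those where the shifted generator has positive degree and the
  rest. Splitting \<open>u\<close> accordingly splits the depolarization into an element of the
  kernel, whose degree is bounded by the number of rows of \<open>g\<close>, and a product of linear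
  forms.\<close>

lemma row_prod_shift_in_ideal_gen:
  assumes g: "g \<in> row_relations n I r" and u: "Poly_Mapping.keys u \<subseteq> UNIV \<times> {..<n}"
    and hom: "multihom (\<lambda>i. if i \<in> {..<e} then d else 0) (Poly_Mapping.single u a * rename (apfst \<iota>) g)"
    and C: "card (\<Union>m\<in>Poly_Mapping.keys g. fst ` Poly_Mapping.keys m) \<le> C"
  shows "row_prod lin {..<e} (Poly_Mapping.single u a * rename (apfst \<iota>) g)
    \<in> ideal_gen (poly_ring N) {p \<in> kernel. total_deg p \<le> C}"
proof (cases "Poly_Mapping.single u a * rename (apfst \<iota>) g = 0")
  case False
  define g' where "g' = rename (apfst \<iota>) g"
  define R where "R = (\<Union>m\<in>Poly_Mapping.keys g. fst ` Poly_Mapping.keys m)"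
  have g'K: "g' \<in> row_relations n I r" unfolding g'_def by (rule row_relations_shift[OF g])
  then obtain \<delta> where \<delta>: "multihom \<delta> g'" by (auto simp: row_relations_def)
  obtain m where m: "m \<in> Poly_Mapping.keys (Poly_Mapping.single u a * g')"
    using False unfolding g'_def by (metis poly_mapping_eqI lookup_zero in_keys_iff)
  obtain w where w: "w \<in> Poly_Mapping.keys g'" "m = u + w" using m keys_single_mult[of u a g'] by blast
  \<comment> \<open>Multidegrees are compared at one occurring monomial, which exists because the
    product is nonzero.\<close>
  have split: "mon_deg (row i u) + \<delta> i = (if i \<in> {..<e} then d else 0)" for i
  proof -
    have "mon_deg (row i m) = (if i \<in> {..<e} then d else 0)"
      using hom m by (simp add: multihom_def g'_def)
    moreover have "mon_deg (row i w) = \<delta> i" using \<delta> w(1) by (simp add: multihom_def)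
    ultimately show ?thesis using w(2) by simp
  qed
  define W where "W = {i. \<delta> i \<noteq> 0}"
  have W_sub: "W \<subseteq> {..<e}" using split by (fastforce simp: W_def split: if_splits)
  have finW: "finite W" using W_sub finite_subset by blast
  have finR: "finite R" by (simp add: R_def)
  \<comment> \<open>Every row of positive degree is the image of a row of \<open>g\<close>, so
    \<open>card W\<close> is bounded independently of \<open>d\<close>, \<open>e\<close> and
    \<open>\<iota>\<close>.\<close>
  have "W \<subseteq> \<iota> ` R"
  proof
    fix i assume "i \<in> W"
    obtain w' where w': "w' \<in> Poly_Mapping.keys g" "w = mon_rename (apfst \<iota>) w'"
      using w(1) keys_rename[of "apfst \<iota>" g] unfolding g'_def by blast
    have "mon_deg (row i w) \<noteq> 0" using \<open>i \<in> W\<close> \<delta> w(1) by (simp add: multihom_def W_def)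
    hence "row i w \<noteq> 0" by auto
    then obtain j where "Poly_Mapping.lookup (row i w) j \<noteq> 0" by (metis poly_mapping_eqI lookup_zero)
    hence "(i, j) \<in> Poly_Mapping.keys w" by (simp add: in_keys_iff)
    then obtain v where "v \<in> Poly_Mapping.keys w'" "(i, j) = apfst \<iota> v"
      using keys_mon_rename[of "apfst \<iota>" w'] w'(2) by blast
    hence "fst v \<in> fst ` Poly_Mapping.keys w'" "i = \<iota> (fst v)" by (auto simp: apfst_def map_prod_def split: prod.splits)
    hence "i = \<iota> (fst v)" "fst v \<in> R" using w'(1) unfolding R_def by blast+
    thus "i \<in> \<iota> ` R" by blast
  qed
  hence "card W \<le> C" using C finR surj_card_le[of R W \<iota>] by (simp add: R_def)
  define u1 where "u1 = (\<Sum>i\<in>W. mon_rename (Pair i) (row i u))"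
  define u2 where "u2 = (\<Sum>i\<in>{..<e} - W. mon_rename (Pair i) (row i u))"
  have u_eq: "u = u1 + u2"
  proof -
    have "row i u = 0" if "i \<notin> {..<e}" for i using split[of i] that by auto
    hence "Poly_Mapping.keys u \<subseteq> {..<e} \<times> UNIV"
      by (auto simp: in_keys_iff) (metis lessThan_iff lookup_row lookup_zero less_irrefl)
    hence "u = (\<Sum>i<e. mon_rename (Pair i) (row i u))" by (intro monomial_rows) auto
    also have "\<dots> = u1 + u2" unfolding u1_def u2_def
      using W_sub by (subst add.commute) (simp add: sum.subset_diff)
    finally show ?thesis .
  qed
  have row_u1: "row i u1 = (if i \<in> W then row i u else 0)" for i
  proof -
    have "row i u1 = (\<Sum>k\<in>W. if i = k then row k u else 0)"
      by (auto simp: u1_def row_sum row_mon_rename_Pair intro!: sum.cong)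
    thus ?thesis using finW by (simp add: sum.delta')
  qed
  have keys_u1: "Poly_Mapping.keys u1 \<subseteq> W \<times> UNIV"
    unfolding u1_def using keys_sum_subset keys_mon_rename by fastforce
  have keys_u2: "Poly_Mapping.keys u2 \<subseteq> ({..<e} - W) \<times> UNIV"
    unfolding u2_def using keys_sum_subset keys_mon_rename by fastforce
  \<comment> \<open>In the rows of \<open>W\<close> the parts of \<open>u\<close> and
    \<open>g'\<close> together have degree \<open>d\<close>, and elsewhere \<open>A\<close> has
    degree 0. Thus \<open>A\<close> is a member of \<open>row_relations\<close> to which
    depolarization over \<open>W\<close> applies.\<close>
  define A where "A = Poly_Mapping.single u1 a * g'"
  have AK: "A \<in> row_relations n I r"
    unfolding A_def using u by (intro row_relations_mult[OF I] g'K) (auto simp: u_eq keys_add_nat)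
  have "multihom (\<lambda>i. mon_deg (row i u1) + \<delta> i) A"
    unfolding A_def by (intro multihom_mult multihom_single \<delta>)
  moreover have "(\<lambda>i. mon_deg (row i u1) + \<delta> i) = (\<lambda>i. if i \<in> W then d else 0)"
  proof
    fix i
    show "mon_deg (row i u1) + \<delta> i = (if i \<in> W then d else 0)"
      using split[of i] W_sub by (auto simp: row_u1) (auto simp: W_def)
  qed
  ultimately have A_hom: "multihom (\<lambda>i. if i \<in> W then d else 0) A" by simp
  have A_vars: "in_vars (W \<times> UNIV) A"
    by (rule in_vars_of_multihom[OF _ A_hom]) (simp_all add: in_vars_UNIV)
  have "row_prod lin W A \<in> {p \<in> kernel. total_deg p \<le> C}"
    using row_prod_in_kernel[OF finW AK A_hom] deg_le_row_prod[OF finW, of A] \<open>card W \<le> C\<close>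
    by (auto simp: total_deg_le_iff deg_le_def intro: order_trans)
  hence "row_prod lin ({..<e} - W) (Poly_Mapping.single u2 1) * row_prod lin W A \<in>
      ideal_gen (poly_ring N) {p \<in> kernel. total_deg p \<le> C}"
    by (intro ideal_gen_gen row_prod_poly)
  also have "row_prod lin ({..<e} - W) (Poly_Mapping.single u2 1) * row_prod lin W A =
      row_prod lin (({..<e} - W) \<union> W) (Poly_Mapping.single u2 1 * A)"
    using finW A_vars keys_u2 by (intro row_prod_mult[symmetric] in_vars_single) auto
  also have "({..<e} - W) \<union> W = {..<e}" using W_sub by blast
  also have "Poly_Mapping.single u2 1 * A = Poly_Mapping.single u a * g'"
    by (simp add: A_def u_eq mult_single add.commute flip: mult.assoc)
  finally show ?thesis by (simp add: g'_def)
qed (simp only: row_prod_0 ideal_gen_0)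

lemma row_prod_shift_span:
  assumes "F \<in> shift_span n G (\<lambda>i. if i \<in> {..<e} then d else 0)" "G \<subseteq> row_relations n I r"
    and "\<And>g. g \<in> G \<Longrightarrow> card (\<Union>m\<in>Poly_Mapping.keys g. fst ` Poly_Mapping.keys m) \<le> C"
  shows "row_prod lin {..<e} F \<in> ideal_gen (poly_ring N) {p \<in> kernel. total_deg p \<le> C}"
  using assms(1)
proof induction
  case zero
  show ?case by (simp only: row_prod_0 ideal_gen_0)
next
  case (step F g \<iota> u a)
  thus ?case using assms(2,3) unfolding row_prod_add
    by (intro ideal_gen_add row_prod_shift_in_ideal_gen) auto
qed

text \<open>A kernel element is the sum of the depolarizations of its polar forms, each of which
  lies in the shift span of \<open>G\<close>. As generators, all kernel elements of degree at most
  \<open>C\<close> are taken.\<close>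

lemma kernel_generated_in_deg_le:
  assumes G: "G \<subseteq> row_relations n I r"
    "\<And>F \<delta>. F \<in> row_relations n I r \<Longrightarrow> multihom \<delta> F \<Longrightarrow> F \<in> shift_span n G \<delta>"
    and C: "\<And>g. g \<in> G \<Longrightarrow> card (\<Union>m\<in>Poly_Mapping.keys g. fst ` Poly_Mapping.keys m) \<le> C"
  shows "generated_in_deg_le N C kernel"
  unfolding generated_in_deg_le_def
proof (intro exI conjI)
  let ?G0 = "{p \<in> kernel. total_deg p \<le> C}"
  show "?G0 \<subseteq> kernel" "\<forall>g\<in>?G0. total_deg g \<le> C" by auto
  show "ideal_gen (poly_ring N) ?G0 = kernel"
  proof
    show "ideal_gen (poly_ring N) ?G0 \<subseteq> kernel"
      by (auto simp: ideal_gen_def intro!: kernel_sum kernel_mult)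
    show "kernel \<subseteq> ideal_gen (poly_ring N) ?G0"
    proof
      fix q assume "q \<in> kernel"
      hence q: "q \<in> poly_ring N" "secant_map r b q \<in> tensor_ideal I r" by (auto simp: kernel_def)
      have "(\<Sum>e\<in>mon_deg ` Poly_Mapping.keys q. row_prod lin {..<e} (polar q e)) \<in> ideal_gen (poly_ring N) ?G0"
        by (intro ideal_gen_sum row_prod_shift_span[OF G(2) G(1) C] polar_in_row_relations[OF q]
            polar_multihom[OF q(1)])
      thus "q \<in> ideal_gen (poly_ring N) ?G0" using sum_row_prod_polar[OF q(1)] by simp
    qed
  qed
qed

end

theorem theorem5p1:
  fixes n :: nat and I :: "('k::field_char_0) mpoly set"
  assumes "conical n I"
  shows "\<forall>r\<ge>1. \<exists>C::nat. \<forall>d\<ge>1. \<forall>N b. basis_mod n I d N b \<longrightarrow>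
            generated_in_deg_le N C (sec_ideal I N b r)"
proof (intro allI impI)
  fix r :: nat assume r: "r \<ge> 1"
  have "is_ideal_in (poly_ring n) I" using assms by (simp add: conical_def)
  \<comment> \<open>\<open>G\<close> is fixed before \<open>d\<close>, \<open>N\<close> and
    \<open>b\<close> appear; the uniformity in \<open>d\<close> rests on this order.\<close>
  then obtain G where G: "G \<subseteq> row_relations n I r" "finite G"
    "\<And>F \<delta>. F \<in> row_relations n I r \<Longrightarrow> multihom \<delta> F \<Longrightarrow> F \<in> shift_span n G \<delta>"
    using row_relations_noetherian[of n I r] by blast
  \<comment> \<open>The bound is the sum of the row counts over \<open>G\<close>: it dominates each
    count and also makes sense for empty \<open>G\<close>.\<close>
  define rows where "rows g = card (\<Union>m\<in>Poly_Mapping.keys g. fst ` Poly_Mapping.keys m)"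
    for g :: "(nat \<times> nat \<Rightarrow>\<^sub>0 nat) \<Rightarrow>\<^sub>0 'k"
  have C: "rows g \<le> (\<Sum>g\<in>G. rows g)" if "g \<in> G" for g
    using that G(2) by (intro member_le_sum) auto
  have "generated_in_deg_le N (\<Sum>g\<in>G. rows g) (sec_ideal I N b r)"
    if "d \<ge> 1" "basis_mod n I d N b" for d N b
  proof -
    interpret veronese_basis n N d r I b by unfold_locales (use assms r that in auto)
    show ?thesis unfolding sec_ideal_eq_kernel
      by (rule kernel_generated_in_deg_le[OF G(1,3)]) (use C in \<open>auto simp: rows_def\<close>)
  qed
  thus "\<exists>C. \<forall>d\<ge>1. \<forall>N b. basis_mod n I d N b \<longrightarrow> generated_in_deg_le N C (sec_ideal I N b r)" by blast
qed

end
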